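(* Every improper locally strongly convex affine sphere in $\mathbb{R}^3$ with nowhere-vanishing Pick invariant is (real) analytic.
   Context: All objects are a priori only assumed smooth ($C^\infty$). Affine surfaces. Let $N$ be an oriented surface (2-dimensional manifold), $f:N\to\mathbb{R}^3$ an immersion, and $\xi$ a vector field along $f$ transversal to $f$. Let $\tilde\nabla$ be the standard flat connection on $\mathbb{R}^3$. The Gauss formula $\tilde\nabla_X(f_*Y)=f_*(\nabla_XY)+g(X,Y)\xi$ defines the induced torsion-free connection $\nabla$ and the second fundamental form $g$, a symmetric bilinear form. The immersion $f$ is non-degenerate if $g$ is nondegenerate at each point (this does not depend on $\xi$), and locally strongly convex if $g$ is definite at each point. The induced volume form is $\nu_\xi(X_1,X_2)=\det(f_*X_1,f_*X_2,\xi)$; $\xi$ (taken consistent with the orientation of $N$) is called equiaffine if $\nabla\nu_\xi=0$. For a non-degenerate $f$ there is a unique equiaffine transversal vector field $\xi$ with $\nu_\xi=\nu_g$, where $\nu_g$ is the volume form of $g$ ($\nu_g(\partial_1,\partial_2)=\sqrt{|\det[g_{ij}]|}$ in positively oriented coordinates). It is called the affine normal, and the corresponding $g$ is called the Blaschke metric of $f$. For the affine normal one has $\tilde\nabla_X\xi=-f_*(SX)$; the $(1,1)$-tensor field $S$ is the affine shape operator. The immersion $f$ is an affine sphere if $S=\lambda\,\mathrm{id}$ for a real constant $\lambda$; it is improper if $\lambda=0$. With $K=\nabla-\hat\nabla$, where $\hat\nabla$ is the Levi-Civita connection of the Blaschke metric $g$, the Pick invariant is the function $J=\tfrac12 g(K,K)$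 (full contraction of $K$ with itself by $g$). Analyticity of the surface $f:N\to\mathbb{R}^3$ means that, locally around each point of $N$ and up to an affine transformation of $\mathbb{R}^3$, the image of $f$ is the graph $\{(x^1,x^2,\Psi(x^1,x^2))\}$ of a real-analytic function $\Psi$ on an open subset of $\mathbb{R}^2$. *)

theory Defs
  imports "HOL-Analysis.Analysis"
begin

section \<open>Smooth and real-analytic functions\<close>

primrec times_differentiable_on ::
  "nat \<Rightarrow> 'a::real_normed_vector set \<Rightarrow> ('a \<Rightarrow> 'b::real_normed_vector) \<Rightarrow> bool" where
  "times_differentiable_on 0 S f \<longleftrightarrow> continuous_on S f"
| "times_differentiable_on (Suc n) S f \<longleftrightarrow>
     (\<forall>x\<in>S. f differentiable (at x)) \<and>
     (\<forall>v. times_differentiable_on n S (\<lambda>x. frechet_derivative f (at x) v))"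

text \<open>Only used for open \<open>S\<close>: all iterated directional derivatives exist and are continuous,
  i.e. \<open>f\<close> is of class \<open>C\<^sup>\<infinity>\<close> on \<open>S\<close>.\<close>

definition smooth_on ::
  "'a::real_normed_vector set \<Rightarrow> ('a \<Rightarrow> 'b::real_normed_vector) \<Rightarrow> bool" where
  "smooth_on S f \<longleftrightarrow> (\<forall>n. times_differentiable_on n S f)"

text \<open>Only used for open \<open>W\<close>: near each point of \<open>W\<close> the function is the sum of an
  (unconditionally convergent) double power series centred at that point.\<close>

definition real_analytic_on :: "(real^2) set \<Rightarrow> (real^2 \<Rightarrow> real) \<Rightarrow> bool" where
  "real_analytic_on W \<Psi> \<longleftrightarrow>
     (\<forall>a\<in>W. \<exists>r>0. \<exists>c :: nat \<times> nat \<Rightarrow> real. \<forall>x\<in>ball a r.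
        ((\<lambda>(i, j). c (i, j) * (x$1 - a$1) ^ i * (x$2 - a$2) ^ j) has_sum \<Psi> x) UNIV)"

section \<open>Oriented surfaces\<close>

type_synonym 'a chart = "'a set \<times> ('a \<Rightarrow> real^2)"

abbreviation coord_dom :: "'a chart \<Rightarrow> (real^2) set" where
  "coord_dom c \<equiv> snd c ` fst c"

definition param :: "'a chart \<Rightarrow> real^2 \<Rightarrow> 'a" where
  "param c = inv_into (fst c) (snd c)"

definition is_chart :: "'a::topological_space chart \<Rightarrow> bool" where
  "is_chart c \<longleftrightarrow> open (fst c) \<and> open (coord_dom c) \<and>
     homeomorphism (fst c) (coord_dom c) (snd c) (param c)"

text \<open>A smooth 2-manifold \<open>N\<close>, with its orientation, is given by an atlas \<open>A\<close> whose coordinate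
  changes are smooth with positive Jacobian determinant; the charts of \<open>A\<close> are the positively
  oriented coordinates.  The Hausdorff and second countability axioms come from the
  type class of the ambient type.  \<open>N\<close> need not be connected.\<close>

definition oriented_surface ::
  "'a::{second_countable_topology, t2_space} set \<Rightarrow> 'a chart set \<Rightarrow> bool" where
  "oriented_surface N A \<longleftrightarrow>
     N = \<Union> (fst ` A) \<and> (\<forall>c\<in>A. is_chart c) \<and>
     (\<forall>c\<in>A. \<forall>d\<in>A.
        smooth_on (snd c ` (fst c \<inter> fst d)) (snd d \<circ> param c) \<and>
        (\<forall>x\<in>snd c ` (fst c \<inter> fst d).
           det (matrix (frechet_derivative (snd d \<circ> param c) (at x))) > 0))"

section \<open>Affine differential geometry of a parametrized surface\<close>

text \<open>Here \<open>F\<close> is a local coordinate expression of the immersion and \<open>Z\<close> the one of the transversal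
  field.  Tangent vectors of the parameter domain are elements of \<open>real^2\<close>; a vector
  \<open>u :: real^2\<close> is also regarded as the vector field with constant components \<open>u\<close>, so the
  coordinate fields are \<open>\<partial>\<^sub>i = axis i 1\<close>.  A connection is represented by its Christoffel symbols,
  as the bilinear map \<open>(u, v) \<mapsto> \<nabla>\<^sub>u v\<close> on constant fields.\<close>

definition ddir ::
  "'b::real_normed_vector \<Rightarrow> ('b \<Rightarrow> 'c::real_normed_vector) \<Rightarrow> 'b \<Rightarrow> 'c" where
  "ddir u h x = frechet_derivative h (at x) u"

text \<open>The decomposition \<open>w = F\<^sub>*X + c Z\<close> of a vector of \<open>real^3\<close> at the point \<open>x\<close>.\<close>

definition decomp ::
  "(real^2 \<Rightarrow> real^3) \<Rightarrow> (real^2 \<Rightarrow> real^3) \<Rightarrow> real^2 \<Rightarrow> real^3 \<Rightarrow> (real^2) \<times> real" where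
  "decomp F Z x w = (THE p. w = ddir (fst p) F x + snd p *\<^sub>R Z x)"

text \<open>The Gauss formula: \<open>\<partial>\<^sub>u (F\<^sub>* v) = F\<^sub>* (\<nabla>\<^sub>u v) + g(u, v) Z\<close>.\<close>

definition conn ::
  "(real^2 \<Rightarrow> real^3) \<Rightarrow> (real^2 \<Rightarrow> real^3) \<Rightarrow> real^2 \<Rightarrow> real^2 \<Rightarrow> real^2 \<Rightarrow> real^2" where
  "conn F Z x u v = fst (decomp F Z x (ddir u (ddir v F) x))"

definition sff ::
  "(real^2 \<Rightarrow> real^3) \<Rightarrow> (real^2 \<Rightarrow> real^3) \<Rightarrow> real^2 \<Rightarrow> real^2 \<Rightarrow> real^2 \<Rightarrow> real" where
  "sff F Z x u v = snd (decomp F Z x (ddir u (ddir v F) x))"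

text \<open>The tangential part of the Weingarten formula \<open>\<partial>\<^sub>u Z = - F\<^sub>*(S u) + \<tau>(u) Z\<close>; for an equiaffine
  field \<open>\<tau> = 0\<close>.\<close>

definition shape_op ::
  "(real^2 \<Rightarrow> real^3) \<Rightarrow> (real^2 \<Rightarrow> real^3) \<Rightarrow> real^2 \<Rightarrow> real^2 \<Rightarrow> real^2" where
  "shape_op F Z x u = - fst (decomp F Z x (ddir u Z x))"

definition vol_form ::
  "(real^2 \<Rightarrow> real^3) \<Rightarrow> (real^2 \<Rightarrow> real^3) \<Rightarrow> real^2 \<Rightarrow> real^2 \<Rightarrow> real^2 \<Rightarrow> real" where
  "vol_form F Z x u v = det (vector [ddir u F x, ddir v F x, Z x] :: real^3^3)"

definition nabla_vol ::
  "(real^2 \<Rightarrow> real^3) \<Rightarrow> (real^2 \<Rightarrow> real^3) \<Rightarrow> real^2 \<Rightarrow> real^2 \<Rightarrow> real^2 \<Rightarrow> real^2 \<Rightarrow> real" where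
  "nabla_vol F Z x u v w =
     ddir u (\<lambda>y. vol_form F Z y v w) x
       - vol_form F Z x (conn F Z x u v) w - vol_form F Z x v (conn F Z x u w)"

definition gram :: "(real^2 \<Rightarrow> real^2 \<Rightarrow> real) \<Rightarrow> real^2^2" where
  "gram b = (\<chi> i j. b (axis i 1) (axis j 1))"

text \<open>Levi-Civita connection of a metric \<open>g\<close> on the parameter domain, by the Koszul formula for
  (commuting) constant fields.\<close>

definition levi_civita ::
  "(real^2 \<Rightarrow> real^2 \<Rightarrow> real^2 \<Rightarrow> real) \<Rightarrow> real^2 \<Rightarrow> real^2 \<Rightarrow> real^2 \<Rightarrow> real^2" where
  "levi_civita g x u v = (THE w. \<forall>z. 2 * g x w z =
     ddir u (\<lambda>y. g y v z) x + ddir v (\<lambda>y. g y u z) x - ddir z (\<lambda>y. g y u v) x)"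

definition diff_tensor ::
  "(real^2 \<Rightarrow> real^3) \<Rightarrow> (real^2 \<Rightarrow> real^3) \<Rightarrow> real^2 \<Rightarrow> real^2 \<Rightarrow> real^2 \<Rightarrow> real^2" where
  "diff_tensor F Z x u v = conn F Z x u v - levi_civita (sff F Z) x u v"

text \<open>\<open>J = \<onehalf> g\<^sup>i\<^sup>a g\<^sup>j\<^sup>b g\<^sub>k\<^sub>c K\<^sup>k\<^sub>i\<^sub>j K\<^sup>c\<^sub>a\<^sub>b\<close>\<close>

definition pick ::
  "(real^2 \<Rightarrow> real^3) \<Rightarrow> (real^2 \<Rightarrow> real^3) \<Rightarrow> real^2 \<Rightarrow> real" where
  "pick F Z x =
     (let G = gram (sff F Z x); H = matrix_inv G;
          K = (\<lambda>k i j. diff_tensor F Z x (axis i 1) (axis j 1) $ k)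
      in (1/2) * (\<Sum>i\<in>UNIV. \<Sum>j\<in>UNIV. \<Sum>k\<in>UNIV. \<Sum>a\<in>UNIV. \<Sum>b\<in>UNIV. \<Sum>c\<in>UNIV.
            H$i$a * H$j$b * G$k$c * K k i j * K c a b))"

section \<open>Surfaces in affine 3-space\<close>

definition immersion_on :: "'a chart set \<Rightarrow> ('a \<Rightarrow> real^3) \<Rightarrow> bool" where
  "immersion_on A f \<longleftrightarrow>
     (\<forall>c\<in>A. smooth_on (coord_dom c) (f \<circ> param c) \<and>
        (\<forall>x\<in>coord_dom c. inj (frechet_derivative (f \<circ> param c) (at x))))"

definition transversal_field :: "'a chart set \<Rightarrow> ('a \<Rightarrow> real^3) \<Rightarrow> ('a \<Rightarrow> real^3) \<Rightarrow> bool" where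
  "transversal_field A f \<xi> \<longleftrightarrow>
     (\<forall>c\<in>A. smooth_on (coord_dom c) (\<xi> \<circ> param c) \<and>
        (\<forall>x\<in>coord_dom c. (\<xi> \<circ> param c) x \<notin> range (frechet_derivative (f \<circ> param c) (at x))))"

definition equiaffine :: "'a chart set \<Rightarrow> ('a \<Rightarrow> real^3) \<Rightarrow> ('a \<Rightarrow> real^3) \<Rightarrow> bool" where
  "equiaffine A f \<xi> \<longleftrightarrow> transversal_field A f \<xi> \<and>
     (\<forall>c\<in>A. \<forall>x\<in>coord_dom c. \<forall>u v w. nabla_vol (f \<circ> param c) (\<xi> \<circ> param c) x u v w = 0)"

text \<open>The condition \<open>\<nu>\<^sub>\<xi> = \<nu>\<^sub>g\<close> is evaluated on \<open>(\<partial>\<^sub>1, \<partial>\<^sub>2)\<close> in the positively oriented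
  coordinates; it also makes \<open>\<xi>\<close> consistent with the orientation.\<close>

definition affine_normal :: "'a chart set \<Rightarrow> ('a \<Rightarrow> real^3) \<Rightarrow> ('a \<Rightarrow> real^3) \<Rightarrow> bool" where
  "affine_normal A f \<xi> \<longleftrightarrow> equiaffine A f \<xi> \<and>
     (\<forall>c\<in>A. \<forall>x\<in>coord_dom c.
        vol_form (f \<circ> param c) (\<xi> \<circ> param c) x (axis 1 1) (axis 2 1) =
        sqrt \<bar>det (gram (sff (f \<circ> param c) (\<xi> \<circ> param c) x))\<bar>)"

text \<open>The sign of the definite form may be either one.\<close>

definition locally_strongly_convex ::
  "'a chart set \<Rightarrow> ('a \<Rightarrow> real^3) \<Rightarrow> ('a \<Rightarrow> real^3) \<Rightarrow> bool" where
  "locally_strongly_convex A f \<xi> \<longleftrightarrow>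
     (\<forall>c\<in>A. \<forall>x\<in>coord_dom c.
        (\<forall>u. u \<noteq> 0 \<longrightarrow> sff (f \<circ> param c) (\<xi> \<circ> param c) x u u > 0) \<or>
        (\<forall>u. u \<noteq> 0 \<longrightarrow> sff (f \<circ> param c) (\<xi> \<circ> param c) x u u < 0))"

text \<open>\<open>affine_sphere A f \<xi> s\<close>: the affine shape operator of \<open>f\<close>, with affine normal \<open>\<xi>\<close>,
  is \<open>s\<close> times the identity.\<close>

definition affine_sphere ::
  "'a chart set \<Rightarrow> ('a \<Rightarrow> real^3) \<Rightarrow> ('a \<Rightarrow> real^3) \<Rightarrow> real \<Rightarrow> bool" where
  "affine_sphere A f \<xi> s \<longleftrightarrow> affine_normal A f \<xi> \<and>
     (\<forall>c\<in>A. \<forall>x\<in>coord_dom c. \<forall>u. shape_op (f \<circ> param c) (\<xi> \<circ> param c) x u = s *\<^sub>R u)"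

abbreviation improper_affine_sphere ::
  "'a chart set \<Rightarrow> ('a \<Rightarrow> real^3) \<Rightarrow> ('a \<Rightarrow> real^3) \<Rightarrow> bool" where
  "improper_affine_sphere A f \<xi> \<equiv> affine_sphere A f \<xi> 0"

text \<open>The Pick invariant at the point \<open>p\<close>, computed in the chart \<open>c\<close>
  (it does not depend on the chart).\<close>

definition pick_invariant ::
  "'a chart \<Rightarrow> ('a \<Rightarrow> real^3) \<Rightarrow> ('a \<Rightarrow> real^3) \<Rightarrow> 'a \<Rightarrow> real" where
  "pick_invariant c f \<xi> p = pick (f \<circ> param c) (\<xi> \<circ> param c) (snd c p)"

definition analytic_surface :: "'a::topological_space set \<Rightarrow> ('a \<Rightarrow> real^3) \<Rightarrow> bool" where
  "analytic_surface N f \<longleftrightarrow>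
     (\<forall>p\<in>N. \<exists>V. open V \<and> p \<in> V \<and> V \<subseteq> N \<and>
        (\<exists>(M :: real^3^3) b W \<Psi>. invertible M \<and> open W \<and> real_analytic_on W \<Psi> \<and>
           (\<lambda>q. M *v f q + b) ` V = (\<lambda>x. vector [x$1, x$2, \<Psi> x]) ` W))"

end

theory Submission
  imports Defs "HOL-Complex_Analysis.Complex_Analysis"
begin

text \<open>
  On an improper affine sphere the affine normal \<open>\<xi>\<close> is locally a constant vector: its derivative has
  no tangential part, because the shape operator vanishes, and no transversal part, because \<open>\<xi>\<close> is
  equiaffine (\<open>ddir_transversal_eq_0\<close>).  In affine coordinates with \<open>\<xi>\<close> vertical the surface is
  locally a graph of a function \<open>\<Psi>\<close> whose Hessian is a constant multiple of the Blaschke metric.  The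
  condition \<open>\<nu>\<^sub>\<xi> = \<nu>\<^sub>g\<close> then becomes a Monge-Ampere equation with constant right-hand side, which a
  suitable scaling makes \<open>det D\<^sup>2\<Psi> = 1\<close>, and local strong convexity means that \<open>\<Psi>\<close> may be taken
  convex (\<open>improper_affine_sphere_local_graph\<close>).

  Convex solutions of this equation in the plane are analytic (\<open>Monge_Ampere_imp_real_analytic\<close>), by the
  transformation of Lewy.  In complex notation, put \<open>P = \<partial>\<^sub>x \<Psi> + \<i> \<partial>\<^sub>y \<Psi>\<close>.  By convexity
  \<open>\<zeta> = w + P w\<close> is a new coordinate, and the Monge-Ampere equation says precisely that the conjugate of
  \<open>w - P w\<close> is a holomorphic function \<open>H\<close> of \<open>\<zeta>\<close>, with \<open>\<bar>H'\<bar> < 1\<close> (\<open>Lewy_transform\<close>).  So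
  \<open>w = (\<zeta> + cnj (H \<zeta>)) / 2\<close>, and \<open>\<Psi>\<close> is an explicit expression in \<open>w\<close>, \<open>\<zeta>\<close>, a primitive of \<open>H\<close> and
  their conjugates (\<open>Monge_Ampere_double_power_series\<close>).  What is left is to solve for \<open>\<zeta>\<close>
  analytically.  For this the conjugates are replaced by independent variables: the resulting
  holomorphic map of two complex variables is injective because \<open>H\<close> is locally a contraction, and
  its inverse is holomorphic (\<open>complexified_Legendre_inverse\<close>).  Thus \<open>\<Psi>\<close> is the restriction of a
  holomorphic function of two variables to the real points, and such a function is a double power series
  by Osgood's lemma (\<open>separately_holomorphic_imp_double_power_series\<close>).
\<close>

(* Frees the dollar sign for vector components. *)
unbundle no fps_syntax

section \<open>Separately holomorphic functions and double power series\<close>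

text \<open>The estimate behind the uniform limit below: its right-hand side involves the coefficients only
  through the Cauchy bounds.\<close>

lemma power_series_tail_le:
  fixes a :: "nat \<Rightarrow> complex"
  assumes sums: "(\<lambda>n. a n * t ^ n) sums S"
    and a: "\<And>n. norm (a n) \<le> M / \<rho> ^ n"
    and t: "t \<noteq> 0" "norm t \<le> \<rho> / 2"
  shows "norm ((S - (\<Sum>n<j. a n * t ^ n)) / t ^ j - a j) \<le> norm t * (2 * M / \<rho> ^ Suc j)"
proof -
  have \<rho>: "\<rho> > 0"
    using less_le_trans[OF zero_less_norm_iff[THEN iffD2, OF t(1)] t(2)] by simp
  have "(\<lambda>n. a (n + Suc j) * t ^ (n + Suc j)) sums (S - (\<Sum>n<Suc j. a n * t ^ n))"
    using sums by (rule sums_split_initial_segment)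
  then have "(\<lambda>n. a (n + Suc j) * t ^ (n + Suc j) / t ^ j) sums ((S - (\<Sum>n<Suc j. a n * t ^ n)) / t ^ j)"
    by (rule sums_divide)
  moreover have "(S - (\<Sum>n<Suc j. a n * t ^ n)) / t ^ j = (S - (\<Sum>n<j. a n * t ^ n)) / t ^ j - a j"
    using t by (simp add: field_simps)
  ultimately have sums': "(\<lambda>n. a (n + Suc j) * t ^ (n + Suc j) / t ^ j) sums
      ((S - (\<Sum>n<j. a n * t ^ n)) / t ^ j - a j)" by simp
  have M: "M \<ge> 0"
    using a[of 0] by (simp add: order_trans[OF norm_ge_zero])
  have le: "norm (a (n + Suc j) * t ^ (n + Suc j) / t ^ j) \<le> norm t * M / \<rho> ^ Suc j * (1/2) ^ n" for n
  proof -
    have "norm (a (n + Suc j) * t ^ (n + Suc j) / t ^ j) = norm (a (n + Suc j)) * norm t ^ Suc n"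
      using t by (simp add: norm_mult norm_divide norm_power power_add field_simps)
    also have "\<dots> \<le> M / \<rho> ^ (n + Suc j) * norm t ^ Suc n"
      by (intro mult_right_mono a) auto
    also have "\<dots> = M * norm t / \<rho> ^ Suc j * (norm t / \<rho>) ^ n"
      by (simp add: power_add field_simps power_divide)
    also have "\<dots> \<le> M * norm t / \<rho> ^ Suc j * (1/2) ^ n"
      using t \<rho> M by (intro mult_left_mono power_mono) (auto simp: field_simps)
    finally show ?thesis by (simp add: mult.commute)
  qed
  have geo: "(\<lambda>n. norm t * M / \<rho> ^ Suc j * (1/2) ^ n) sums (norm t * M / \<rho> ^ Suc j * 2)"
    using sums_mult[OF geometric_sums[of "1/2::real"], of "norm t * M / \<rho> ^ Suc j"] by simp
  have "norm ((S - (\<Sum>n<j. a n * t ^ n)) / t ^ j - a j) \<le> norm t * M / \<rho> ^ Suc j * 2"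
    using norm_suminf_le[OF le sums_summable[OF geo]] sums_unique[OF sums'] sums_unique[OF geo]
    by simp
  then show ?thesis by (simp add: field_simps)
qed

text \<open>By induction, the \<open>j\<close>-th Taylor coefficient is the limit of the holomorphic functions
  \<open>(f z (w0 + t) - (\<Sum>k<j. a k z * t ^ k)) / t ^ j\<close> for \<open>t \<rightarrow> 0\<close>, and the bound on \<open>f\<close> makes this
  limit uniform in \<open>z\<close> through the Cauchy estimates.\<close>

lemma holomorphic_Taylor_coefficients:
  fixes f :: "complex \<Rightarrow> complex \<Rightarrow> complex"
  assumes r: "r > 0"
    and bound: "\<And>z w. z \<in> U \<Longrightarrow> w \<in> ball w0 r \<Longrightarrow> norm (f z w) \<le> M"
    and hol1: "\<And>w. w \<in> ball w0 r \<Longrightarrow> (\<lambda>z. f z w) holomorphic_on U"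
    and hol2: "\<And>z. z \<in> U \<Longrightarrow> f z holomorphic_on ball w0 r"
    and U: "open U"
  shows "(\<lambda>z. (deriv ^^ j) (f z) w0 / fact j) holomorphic_on U"
proof (induction j rule: less_induct)
  case (less j)
  define \<rho> where "\<rho> = r / 2"
  have \<rho>: "0 < \<rho>" "\<rho> < r" using r by (auto simp: \<rho>_def)
  let ?a = "\<lambda>j z. (deriv ^^ j) (f z) w0 / fact j"
  have a_le: "norm (?a n z) \<le> M / \<rho> ^ n" if z: "z \<in> U" for n z
  proof -
    have "norm ((deriv ^^ n) (f z) w0) \<le> fact n * M / \<rho> ^ n"
    proof (rule Cauchy_inequality)
      have sub: "cball w0 \<rho> \<subseteq> ball w0 r" using \<rho> by auto
      show "f z holomorphic_on ball w0 \<rho>"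
        using hol2[OF z] by (rule holomorphic_on_subset) (use \<rho> in auto)
      show "continuous_on (cball w0 \<rho>) (f z)"
        using holomorphic_on_imp_continuous_on[OF hol2[OF z]] sub by (rule continuous_on_subset)
      show "norm (f z x) \<le> M" if "norm (w0 - x) = \<rho>" for x
        using that \<rho> by (intro bound z) (auto simp: dist_norm)
    qed (use \<rho> in auto)
    then show ?thesis by (simp add: norm_divide field_simps)
  qed
  \<comment> \<open>Any null sequence of nonzero points with \<open>norm (t n) \<le> \<rho> / 2\<close> serves.\<close>
  define t :: "nat \<Rightarrow> complex" where "t = (\<lambda>n. of_real (\<rho> / 2 / Suc n))"
  have t: "t n \<noteq> 0" "norm (t n) \<le> \<rho> / 2" for n
    using \<rho> by (auto simp: t_def field_simps simp del: of_nat_Suc of_real_divide)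
  have tr: "w0 + t n \<in> ball w0 r" for n
    using t(2)[of n] \<rho> by (auto simp: dist_norm)
  define F where "F = (\<lambda>n z. (f z (w0 + t n) - (\<Sum>k<j. ?a k z * t n ^ k)) / t n ^ j)"
  show ?case
  proof (rule holomorphic_uniform_sequence[OF U, of F])
    show "F n holomorphic_on U" for n
      unfolding F_def using t(1) by (intro holomorphic_intros hol1 tr less) auto
    have lim: "uniform_limit U F (?a j) sequentially"
    proof (rule uniform_limitI)
      fix e :: real assume e: "e > 0"
      have "(\<lambda>n. \<rho> / 2 * (2 * M / \<rho> ^ Suc j) * inverse (real (Suc n))) \<longlonglongrightarrow> \<rho> / 2 * (2 * M / \<rho> ^ Suc j) * 0"
        by (intro tendsto_intros LIMSEQ_inverse_real_of_nat)
      then have "\<forall>\<^sub>F n in sequentially. \<rho> / 2 * (2 * M / \<rho> ^ Suc j) * inverse (real (Suc n)) < e"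
        using e by (intro order_tendstoD(2)[where a = e]) auto
      then show "\<forall>\<^sub>F n in sequentially. \<forall>z\<in>U. dist (F n z) (?a j z) < e"
      proof eventually_elim
        case (elim n)
        show ?case
        proof
          fix z assume z: "z \<in> U"
          have s: "(\<lambda>k. ?a k z * t n ^ k) sums f z (w0 + t n)"
            using holomorphic_power_series[OF hol2[OF z] tr[of n]] by simp
          have "dist (F n z) (?a j z) \<le> norm (t n) * (2 * M / \<rho> ^ Suc j)"
            unfolding F_def dist_norm
            by (rule power_series_tail_le[OF s a_le[OF z] t])
          also have "\<dots> = \<rho> / 2 * (2 * M / \<rho> ^ Suc j) * inverse (real (Suc n))"
            using \<rho> by (simp add: t_def field_simps norm_mult norm_divide del: of_nat_Suc)
          finally show "dist (F n z) (?a j z) < e" using elim by linarith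
        qed
      qed
    qed
    show "\<exists>d>0. cball x d \<subseteq> U \<and> uniform_limit (cball x d) F (?a j) sequentially" if "x \<in> U" for x
      using open_contains_cball_eq[OF U] that uniform_limit_on_subset[OF lim] by metis
  qed
qed

text \<open>Osgood's lemma in the form needed here.  One expands in \<open>w\<close>, and then each coefficient in \<open>z\<close>;
  two rounds of Cauchy estimates bound the double coefficients geometrically, so that the iterated
  sum may be read as an unconditional sum over pairs.\<close>

lemma separately_holomorphic_imp_double_power_series:
  fixes f :: "complex \<Rightarrow> complex \<Rightarrow> complex"
  assumes r: "r > 0"
    and bound: "\<And>z w. z \<in> ball z0 r \<Longrightarrow> w \<in> ball w0 r \<Longrightarrow> norm (f z w) \<le> M"
    and hol1: "\<And>w. w \<in> ball w0 r \<Longrightarrow> (\<lambda>z. f z w) holomorphic_on ball z0 r"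
    and hol2: "\<And>z. z \<in> ball z0 r \<Longrightarrow> f z holomorphic_on ball w0 r"
  obtains c where "\<And>z w. z \<in> ball z0 (r/4) \<Longrightarrow> w \<in> ball w0 (r/4) \<Longrightarrow>
     ((\<lambda>(i, j). c (i, j) * (z - z0) ^ i * (w - w0) ^ j) has_sum f z w) UNIV"
proof -
  define \<rho> where "\<rho> = r / 2"
  have \<rho>: "0 < \<rho>" "\<rho> < r" using r by (auto simp: \<rho>_def)
  have sub: "cball x \<rho> \<subseteq> ball x r" for x :: complex using \<rho> by auto
  define a where "a = (\<lambda>j z. (deriv ^^ j) (f z) w0 / fact j)"
  define c where "c = (\<lambda>(i, j). (deriv ^^ i) (a j) z0 / fact i)"
  have Cauchy: "norm ((deriv ^^ n) g x / fact n) \<le> B / \<rho> ^ n"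
    if g: "g holomorphic_on ball x r" and B: "\<And>y. y \<in> ball x r \<Longrightarrow> norm (g y) \<le> B"
    for n g x and B :: real
  proof -
    have "norm ((deriv ^^ n) g x) \<le> fact n * B / \<rho> ^ n"
    proof (rule Cauchy_inequality)
      show "g holomorphic_on ball x \<rho>"
        using g by (rule holomorphic_on_subset) (use \<rho> in auto)
      show "continuous_on (cball x \<rho>) g"
        using holomorphic_on_imp_continuous_on[OF g] sub by (rule continuous_on_subset)
      show "norm (g y) \<le> B" if "norm (x - y) = \<rho>" for y
        using that \<rho> by (intro B) (auto simp: dist_norm)
    qed (use \<rho> in auto)
    then show ?thesis by (simp add: norm_divide field_simps)
  qed
  have hol_a: "a j holomorphic_on ball z0 r" for j
    unfolding a_def by (rule holomorphic_Taylor_coefficients[OF r bound hol1 hol2]) auto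
  have a_le: "norm (a j z) \<le> M / \<rho> ^ j" if "z \<in> ball z0 r" for j z
    unfolding a_def using that by (intro Cauchy hol2 bound)
  have c_le: "norm (c (i, j)) \<le> M / \<rho> ^ j / \<rho> ^ i" for i j
    unfolding c_def prod.case by (intro Cauchy hol_a a_le)
  have M: "M \<ge> 0"
    using bound[of z0 w0] r by (auto intro: order_trans[OF norm_ge_zero])
  show thesis
  proof (rule that)
    fix z w assume z: "z \<in> ball z0 (r/4)" and w: "w \<in> ball w0 (r/4)"
    let ?s = "z - z0" and ?t = "w - w0"
    let ?g = "\<lambda>(i, j). c (i, j) * ?s ^ i * ?t ^ j"
    have s: "norm ?s \<le> \<rho> / 2" and t: "norm ?t \<le> \<rho> / 2"
      using z w by (auto simp: \<rho>_def dist_norm norm_minus_commute)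
    have zr: "z \<in> ball z0 r" and wr: "w \<in> ball w0 r" using z w r by auto
    have half: "norm x ^ n / \<rho> ^ n \<le> (1/2) ^ n" if "norm x \<le> \<rho> / 2" for x :: complex and n
      unfolding power_divide[symmetric] using that \<rho> by (intro power_mono) (auto simp: field_simps)
    have g_le: "norm (?g (i, j)) \<le> M * (1/2) ^ j * (1/2) ^ i" for i j
    proof -
      have "norm (?g (i, j)) \<le> M / \<rho> ^ j / \<rho> ^ i * norm ?s ^ i * norm ?t ^ j"
        by (simp only: prod.case norm_mult norm_power) (intro mult_right_mono c_le; simp)
      also have "\<dots> = M * (norm ?t ^ j / \<rho> ^ j) * (norm ?s ^ i / \<rho> ^ i)" by simp
      also have "\<dots> \<le> M * (1/2) ^ j * (1/2) ^ i"
        using M \<rho> by (intro mult_mono half s t) auto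
      finally show ?thesis .
    qed
    have geo: "((\<lambda>n. C * (1/2) ^ n) has_sum (C * 2)) UNIV" if "C \<ge> 0" for C :: real
      using sums_mult[OF geometric_sums[of "1/2::real"], of C] that
      by (intro sums_nonneg_imp_has_sum) auto
    \<comment> \<open>Sums over pairs are rearranged with the outer index \<open>j\<close> first, and swapped at the end.\<close>
    have geo2: "(\<lambda>(j, i). M * (1/2) ^ j * (1/2) ^ i) summable_on (UNIV \<times> UNIV :: (nat \<times> nat) set)"
    proof (rule has_sum_imp_summable, rule has_sum_SigmaI)
      show "((\<lambda>i. case (j, i) of (j, i) \<Rightarrow> M * (1/2) ^ j * (1/2) ^ i) has_sum (M * (1/2) ^ j * 2)) UNIV" for j :: nat
        using M by (simp del: mult_of_nat_commute) (rule geo; simp)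
      show "((\<lambda>j. M * (1/2) ^ j * 2) has_sum (M * 2 * 2)) UNIV"
        using M geo[of "M * 2"] by (simp add: mult_ac)
      show "(\<lambda>(j, i). M * (1/2) ^ j * (1/2) ^ i) summable_on (UNIV \<times> UNIV :: (nat \<times> nat) set)"
      proof (rule nonneg_bdd_above_summable_on)
        show "bdd_above (sum (\<lambda>(j, i). M * (1 / 2) ^ j * (1 / 2) ^ i) ` {F. F \<subseteq> (UNIV \<times> UNIV :: (nat \<times> nat) set) \<and> finite F})"
        proof (rule bdd_aboveI2)
          fix F :: "(nat \<times> nat) set"
          assume "F \<in> {F. F \<subseteq> UNIV \<times> UNIV \<and> finite F}"
          then have fin: "finite F" by auto
          have part: "(\<Sum>n\<in>A. (1/2::real) ^ n) \<le> 2" if "finite A" for A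
            using finite_sum_le_has_sum[OF geo[of 1] that] by simp
          have "(\<Sum>(j, i)\<in>F. M * (1 / 2) ^ j * (1 / 2) ^ i) \<le> (\<Sum>(j, i)\<in>fst ` F \<times> snd ` F. M * (1 / 2) ^ j * (1 / 2) ^ i)"
            using fin M by (intro sum_mono2 subset_fst_snd) auto
          also have "\<dots> = M * (\<Sum>j\<in>fst ` F. (1/2) ^ j) * (\<Sum>i\<in>snd ` F. (1/2) ^ i)"
            by (simp only: sum.cartesian_product[symmetric] sum_product sum_distrib_left[of M])
          also have "\<dots> \<le> M * 2 * 2"
            using M fin by (intro mult_mono part) (auto intro: sum_nonneg)
          finally show "(\<Sum>(j, i)\<in>F. M * (1 / 2) ^ j * (1 / 2) ^ i) \<le> M * 2 * 2" .
        qed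
      qed (use M in auto)
    qed
    let ?h = "\<lambda>(j, i). c (i, j) * ?s ^ i * ?t ^ j"
    have "?h summable_on (UNIV \<times> UNIV)"
    proof (rule abs_summable_summable, rule Infinite_Sum.abs_summable_on_comparison_test'[OF geo2])
      fix x :: "nat \<times> nat"
      show "norm (?h x) \<le> (\<lambda>(j, i). M * (1/2) ^ j * (1/2) ^ i) x"
        using g_le[of "snd x" "fst x"] by (simp add: case_prod_beta)
    qed
    then have "(?h has_sum f z w) (UNIV \<times> UNIV)"
    proof (rule has_sum_SigmaI[rotated -1])
      fix j :: nat
      have "((\<lambda>i. (c (i, j) * ?s ^ i) * ?t ^ j) sums (a j z * ?t ^ j))"
        using holomorphic_power_series[OF hol_a zr, of j] by (intro sums_mult2) (simp add: c_def)
      moreover have "summable (\<lambda>i. norm (c (i, j) * ?s ^ i * ?t ^ j))"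
      proof (rule summable_comparison_test'[where g = "\<lambda>i. M * (1/2) ^ j * (1/2) ^ i" and N = 0])
        show "norm (norm (c (i, j) * ?s ^ i * ?t ^ j)) \<le> M * (1/2) ^ j * (1/2) ^ i" for i
          using g_le[of i j] by simp
      qed (rule summable_mult, rule summable_geometric, simp)
      ultimately show "((\<lambda>i. ?h (j, i)) has_sum (a j z * ?t ^ j)) UNIV"
        unfolding prod.case by (intro norm_summable_imp_has_sum)
    next
      have "(\<lambda>j. a j z * ?t ^ j) sums f z w"
        using holomorphic_power_series[OF hol2[OF zr] wr] by (simp add: a_def)
      moreover have "summable (\<lambda>j. norm (a j z * ?t ^ j))"
      proof (rule summable_comparison_test'[where g = "\<lambda>j. M * (1/2) ^ j" and N = 0])
        fix j
        have "norm (a j z * ?t ^ j) \<le> M / \<rho> ^ j * norm ?t ^ j"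
          by (simp only: norm_mult norm_power) (intro mult_right_mono a_le zr; simp)
        also have "\<dots> \<le> M * (1/2) ^ j"
          using mult_left_mono[OF half[OF t, of j] M] by simp
        finally show "norm (norm (a j z * ?t ^ j)) \<le> M * (1/2) ^ j" by simp
      qed (rule summable_mult, rule summable_geometric, simp)
      ultimately show "((\<lambda>j. a j z * ?t ^ j) has_sum f z w) UNIV"
        by (intro norm_summable_imp_has_sum)
    qed
    then show "(?g has_sum f z w) UNIV"
      by (subst (asm) has_sum_swap) (simp only: prod.case UNIV_Times_UNIV)
  qed
qed

section \<open>Holomorphic functions of two variables\<close>

text \<open>Complex differentiability in two variables is phrased through the real Frechet derivative, which has
  to be complex linear.  In this form the chain rule and the inverse function rule of real calculus
  apply directly.\<close>

definition holomorphic2_on ::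
  "(complex \<times> complex \<Rightarrow> complex) \<Rightarrow> (complex \<times> complex) set \<Rightarrow> bool" where
  "holomorphic2_on f V \<longleftrightarrow>
     (\<forall>p\<in>V. \<exists>c d. (f has_derivative (\<lambda>(x, y). c * x + d * y)) (at p))"

lemma holomorphic2_onI:
  assumes "\<And>p. p \<in> V \<Longrightarrow> (f has_derivative (\<lambda>(x, y). c p * x + d p * y)) (at p)"
  shows "holomorphic2_on f V"
  using assms unfolding holomorphic2_on_def by blast

lemma holomorphic2_on_const: "holomorphic2_on (\<lambda>p. k) V"
  by (rule holomorphic2_onI[where c = "\<lambda>_. 0" and d = "\<lambda>_. 0"]) (simp add: case_prod_unfold)

lemma holomorphic2_on_fst: "holomorphic2_on fst V"
  by (rule holomorphic2_onI[where c = "\<lambda>_. 1" and d = "\<lambda>_. 0"])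
     (auto simp: case_prod_unfold intro!: derivative_eq_intros)

lemma holomorphic2_on_snd: "holomorphic2_on snd V"
  by (rule holomorphic2_onI[where c = "\<lambda>_. 0" and d = "\<lambda>_. 1"])
     (auto simp: case_prod_unfold intro!: derivative_eq_intros)

lemma holomorphic2_on_add:
  assumes "holomorphic2_on f V" "holomorphic2_on g V"
  shows "holomorphic2_on (\<lambda>p. f p + g p) V"
  unfolding holomorphic2_on_def
proof
  fix p assume p: "p \<in> V"
  obtain c d c' d' where
    "(f has_derivative (\<lambda>(x, y). c * x + d * y)) (at p)"
    "(g has_derivative (\<lambda>(x, y). c' * x + d' * y)) (at p)"
    using assms p unfolding holomorphic2_on_def by meson
  then have "((\<lambda>p. f p + g p) has_derivative (\<lambda>(x, y). (c + c') * x + (d + d') * y)) (at p)"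
    by (auto intro!: derivative_eq_intros simp: case_prod_unfold algebra_simps)
  then show "\<exists>c d. ((\<lambda>p. f p + g p) has_derivative (\<lambda>(x, y). c * x + d * y)) (at p)" by blast
qed

lemma holomorphic2_on_mult:
  assumes "holomorphic2_on f V" "holomorphic2_on g V"
  shows "holomorphic2_on (\<lambda>p. f p * g p) V"
  unfolding holomorphic2_on_def
proof
  fix p assume p: "p \<in> V"
  obtain c d c' d' where
    "(f has_derivative (\<lambda>(x, y). c * x + d * y)) (at p)"
    "(g has_derivative (\<lambda>(x, y). c' * x + d' * y)) (at p)"
    using assms p unfolding holomorphic2_on_def by meson
  then have "((\<lambda>p. f p * g p) has_derivative
      (\<lambda>(x, y). (f p * c' + c * g p) * x + (f p * d' + d * g p) * y)) (at p)"
    by (auto intro!: derivative_eq_intros simp: case_prod_unfold algebra_simps)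
  then show "\<exists>c d. ((\<lambda>p. f p * g p) has_derivative (\<lambda>(x, y). c * x + d * y)) (at p)" by blast
qed

lemma holomorphic2_on_diff:
  assumes "holomorphic2_on f V" "holomorphic2_on g V"
  shows "holomorphic2_on (\<lambda>p. f p - g p) V"
  using holomorphic2_on_add[OF assms(1) holomorphic2_on_mult[OF holomorphic2_on_const[of "-1"] assms(2)]]
  by simp

lemma holomorphic2_on_compose:
  assumes g: "g holomorphic_on S" "open S"
    and f: "holomorphic2_on f V" and sub: "\<And>p. p \<in> V \<Longrightarrow> f p \<in> S"
  shows "holomorphic2_on (\<lambda>p. g (f p)) V"
  unfolding holomorphic2_on_def
proof
  fix p assume p: "p \<in> V"
  obtain c d where f': "(f has_derivative (\<lambda>(x, y). c * x + d * y)) (at p)"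
    using f p unfolding holomorphic2_on_def by meson
  have "(g has_derivative (\<lambda>x. deriv g (f p) * x)) (at (f p))"
    using holomorphic_derivI[OF g sub[OF p]] by (rule has_field_derivative_imp_has_derivative)
  from has_derivative_compose[OF f' this]
  have "((\<lambda>p. g (f p)) has_derivative (\<lambda>(x, y). (deriv g (f p) * c) * x + (deriv g (f p) * d) * y)) (at p)"
    by (simp add: case_prod_unfold algebra_simps)
  then show "\<exists>c d. ((\<lambda>p. g (f p)) has_derivative (\<lambda>(x, y). c * x + d * y)) (at p)" by blast
qed

lemma holomorphic2_on_compose2:
  assumes f: "holomorphic2_on f V"
    and g: "holomorphic2_on g U" "holomorphic2_on h U"
    and sub: "\<And>p. p \<in> U \<Longrightarrow> (g p, h p) \<in> V"
  shows "holomorphic2_on (\<lambda>p. f (g p, h p)) U"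
  unfolding holomorphic2_on_def
proof
  fix p assume p: "p \<in> U"
  obtain c d where f': "(f has_derivative (\<lambda>(x, y). c * x + d * y)) (at (g p, h p))"
    using f sub[OF p] unfolding holomorphic2_on_def by meson
  obtain a b a' b' where
    "(g has_derivative (\<lambda>(x, y). a * x + b * y)) (at p)"
    "(h has_derivative (\<lambda>(x, y). a' * x + b' * y)) (at p)"
    using g p unfolding holomorphic2_on_def by meson
  then have "((\<lambda>p. (g p, h p)) has_derivative
      (\<lambda>z. ((\<lambda>(x, y). a * x + b * y) z, (\<lambda>(x, y). a' * x + b' * y) z))) (at p)"
    by (rule has_derivative_Pair)
  from has_derivative_compose[OF this f']
  have "((\<lambda>p. f (g p, h p)) has_derivative
      (\<lambda>(x, y). (c * a + d * a') * x + (c * b + d * b') * y)) (at p)"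
    by (simp add: case_prod_unfold algebra_simps)
  then show "\<exists>c d. ((\<lambda>p. f (g p, h p)) has_derivative (\<lambda>(x, y). c * x + d * y)) (at p)" by blast
qed

lemmas holomorphic2_intros =
  holomorphic2_on_const holomorphic2_on_fst holomorphic2_on_snd
  holomorphic2_on_add holomorphic2_on_mult holomorphic2_on_diff

text \<open>Complex differentiability in both variables together gives separate holomorphy and, on a compact
  ball, the bound required by Osgood's lemma.\<close>

lemma holomorphic2_on_imp_double_power_series:
  assumes f: "holomorphic2_on f V" and V: "open V" "(z0, w0) \<in> V"
  obtains r c where "r > 0" "\<And>z w. z \<in> ball z0 r \<Longrightarrow> w \<in> ball w0 r \<Longrightarrow>
     ((\<lambda>(i, j). c (i, j) * (z - z0) ^ i * (w - w0) ^ j) has_sum f (z, w)) UNIV"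
proof -
  have der: "\<exists>c d. (f has_derivative (\<lambda>(x, y). c * x + d * y)) (at p)" if "p \<in> V" for p
    using f that unfolding holomorphic2_on_def by blast
  have cont: "continuous_on V f"
    using der by (meson continuous_at_imp_continuous_on has_derivative_continuous)
  obtain e where e: "e > 0" "cball (z0, w0) e \<subseteq> V"
    using V open_contains_cball by blast
  have "compact (f ` cball (z0, w0) e)"
    using e by (intro compact_continuous_image continuous_on_subset[OF cont]) auto
  then obtain M where M: "\<And>p. p \<in> cball (z0, w0) e \<Longrightarrow> norm (f p) \<le> M"
    unfolding compact_eq_bounded_closed bounded_iff by blast
  have sub: "(z, w) \<in> cball (z0, w0) e" if "z \<in> ball z0 (e/2)" "w \<in> ball w0 (e/2)" for z w
  proof -
    have "dist (z0, w0) (z, w) \<le> dist z0 z + dist w0 w"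
      unfolding dist_Pair_Pair by (rule order_trans[OF sqrt_sum_squares_le_sum]) auto
    then show ?thesis using that by auto
  qed
  have r: "e / 2 > 0" using e by simp
  have hol1: "(\<lambda>z. f (z, w)) holomorphic_on ball z0 (e/2)" if w: "w \<in> ball w0 (e/2)" for w
    unfolding holomorphic_on_open[OF open_ball]
  proof (intro ballI allI impI)
    fix z assume z: "z \<in> ball z0 (e/2)"
    obtain c d where 1: "(f has_derivative (\<lambda>(x, y). c * x + d * y)) (at (z, w))"
      using der sub[OF z w] e by blast
    have "((\<lambda>z. (z, w)) has_derivative (\<lambda>x. (x, 0))) (at z)"
      by (auto intro!: derivative_eq_intros)
    from has_derivative_compose[OF this 1]
    have "((\<lambda>z. f (z, w)) has_field_derivative c) (at z)"
      by (simp add: has_field_derivative_def case_prod_unfold)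
    then show "\<exists>c. ((\<lambda>z. f (z, w)) has_field_derivative c) (at z)" by blast
  qed
  have hol2: "(\<lambda>w. f (z, w)) holomorphic_on ball w0 (e/2)" if z: "z \<in> ball z0 (e/2)" for z
    unfolding holomorphic_on_open[OF open_ball]
  proof (intro ballI allI impI)
    fix w assume w: "w \<in> ball w0 (e/2)"
    obtain c d where 1: "(f has_derivative (\<lambda>(x, y). c * x + d * y)) (at (z, w))"
      using der sub[OF z w] e by blast
    have "((\<lambda>w. (z, w)) has_derivative (\<lambda>y. (0, y))) (at w)"
      by (auto intro!: derivative_eq_intros)
    from has_derivative_compose[OF this 1]
    have "((\<lambda>w. f (z, w)) has_field_derivative d) (at w)"
      by (simp add: has_field_derivative_def case_prod_unfold)
    then show "\<exists>c. ((\<lambda>w. f (z, w)) has_field_derivative c) (at w)" by blast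
  qed
  show thesis
  proof (rule separately_holomorphic_imp_double_power_series[OF r, of z0 w0 "\<lambda>z w. f (z, w)" M])
    fix c assume "\<And>z w. z \<in> ball z0 (e/2/4) \<Longrightarrow> w \<in> ball w0 (e/2/4) \<Longrightarrow>
     ((\<lambda>(i, j). c (i, j) * (z - z0) ^ i * (w - w0) ^ j) has_sum f (z, w)) UNIV"
    then show thesis using that[of "e/2/4" c] e by simp
  qed (use M sub hol1 hol2 in auto)
qed

section \<open>The Lewy transform\<close>

lemma cmod_less_of_det:
  assumes "\<alpha>\<^sup>2 - (cmod \<beta>)\<^sup>2 = 1" "\<alpha> > 0"
  shows "cmod \<beta> < \<alpha>"
proof (rule power2_less_imp_less)
  show "(cmod \<beta>)\<^sup>2 < \<alpha>\<^sup>2" using assms(1) by linarith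
qed (use assms(2) in linarith)

text \<open>A real linear map of the plane is written as \<open>z \<mapsto> \<alpha> z + \<beta> cnj z\<close>.  It is symmetric iff \<open>\<alpha>\<close> is
  real, its determinant is \<open>\<alpha>\<^sup>2 - \<bar>\<beta>\<bar>\<^sup>2\<close>, and if it is symmetric with determinant 1 and \<open>\<alpha> > 0\<close>
  then it is positive definite, because \<open>\<bar>\<beta>\<bar> < \<alpha>\<close>.  So \<open>P\<close> behaves like the gradient of a strictly convex
  function, and the mean value theorem along a segment gives monotonicity.\<close>

lemma gradient_strictly_monotone:
  fixes P :: "complex \<Rightarrow> complex" and \<alpha> :: "complex \<Rightarrow> real"
  assumes D: "convex D"
    and dP: "\<And>w. w \<in> D \<Longrightarrow> (P has_derivative (\<lambda>z. of_real (\<alpha> w) * z + \<beta> w * cnj z)) (at w)"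
    and det: "\<And>w. w \<in> D \<Longrightarrow> (\<alpha> w)\<^sup>2 - (cmod (\<beta> w))\<^sup>2 = 1" "\<And>w. w \<in> D \<Longrightarrow> \<alpha> w > 0"
    and w: "w \<in> D" "w' \<in> D" "w \<noteq> w'"
  shows "Re (cnj (w' - w) * (P w' - P w)) > 0"
proof -
  define d where "d = w' - w"
  have d: "d \<noteq> 0" using w by (simp add: d_def)
  define \<gamma> where "\<gamma> t = w + of_real t * d" for t :: real
  have mem: "\<gamma> t \<in> D" if "0 \<le> t" "t \<le> 1" for t
  proof -
    have "\<gamma> t = (1 - t) *\<^sub>R w + t *\<^sub>R w'"
      by (simp add: \<gamma>_def d_def scaleR_conv_of_real algebra_simps)
    then show ?thesis using convexD_alt[OF D w(1,2)] that by simp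
  qed
  define \<phi> where "\<phi> t = Re (cnj d * P (\<gamma> t))" for t
  define \<phi>' where "\<phi>' t s = Re (cnj d * (of_real (\<alpha> (\<gamma> t)) * (of_real s * d) + \<beta> (\<gamma> t) * cnj (of_real s * d)))"
    for t s :: real
  have "\<exists>t\<in>{0<..<1}. \<phi> 1 - \<phi> 0 = \<phi>' t (1 - 0)"
  proof (rule mvt_simple)
    fix t :: real assume t: "0 \<le> t" "t \<le> 1"
    have "(\<gamma> has_derivative (\<lambda>s. of_real s * d)) (at t within {0..1})"
      unfolding \<gamma>_def by (auto intro!: derivative_eq_intros)
    from has_derivative_compose[OF this dP[OF mem[OF t]]]
    show "(\<phi> has_derivative \<phi>' t) (at t within {0..1})"
      unfolding \<phi>_def \<phi>'_def by (auto intro!: derivative_eq_intros)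
  qed simp
  then obtain t where t: "0 < t" "t < 1" "\<phi> 1 - \<phi> 0 = \<phi>' t 1" by auto
  have tD: "\<gamma> t \<in> D" using mem t by simp
  have "\<phi>' t 1 = \<alpha> (\<gamma> t) * (cmod d)\<^sup>2 + Re (\<beta> (\<gamma> t) * (cnj d)\<^sup>2)"
    unfolding cmod_power2 by (simp add: \<phi>'_def power2_eq_square algebra_simps)
  moreover have "Re (\<beta> (\<gamma> t) * (cnj d)\<^sup>2) \<ge> - (cmod (\<beta> (\<gamma> t)) * (cmod d)\<^sup>2)"
    using abs_Re_le_cmod[of "\<beta> (\<gamma> t) * (cnj d)\<^sup>2"] by (simp add: norm_mult norm_power)
  ultimately have "\<phi>' t 1 \<ge> (\<alpha> (\<gamma> t) - cmod (\<beta> (\<gamma> t))) * (cmod d)\<^sup>2"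
    by (simp add: algebra_simps)
  moreover have "(\<alpha> (\<gamma> t) - cmod (\<beta> (\<gamma> t))) * (cmod d)\<^sup>2 > 0"
    using cmod_less_of_det[OF det(1,2)[OF tD]] d by simp
  ultimately have "\<phi> 1 - \<phi> 0 > 0" using t(3) by linarith
  then show ?thesis by (simp add: \<phi>_def \<gamma>_def d_def algebra_simps)
qed

text \<open>The inverse of the differential \<open>v \<mapsto> (1 + A) v + b v'\<close> of the Lewy map, where \<open>v'\<close> and \<open>b'\<close> stand
  for complex conjugates, and its composition with the differential of \<open>w - P w\<close>.  The second
  formula contains \<open>v'\<close> only: up to conjugation, this is the Cauchy-Riemann equation for \<open>H\<close> below.\<close>

lemma Lewy_differential_inverse:
  fixes A b b' v v' :: complex
  assumes bb: "b * b' = A\<^sup>2 - 1" and nz: "1 + A \<noteq> 0"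
  shows "(1 + A) * (((1 + A) * v - b * v') / (2 * (1 + A))) + b * (((1 + A) * v' - b' * v) / (2 * (1 + A))) = v"
    and "((1 + A) * v - b * v') / (2 * (1 + A)) -
      (A * (((1 + A) * v - b * v') / (2 * (1 + A))) + b * (((1 + A) * v' - b' * v) / (2 * (1 + A)))) =
      - b * v' / (1 + A)"
proof -
  have "(1 + A) * ((1 + A) * v - b * v') + b * ((1 + A) * v' - b' * v) = ((1 + A)\<^sup>2 - b * b') * v"
    by (simp add: algebra_simps power2_eq_square)
  also have "\<dots> = v * (2 * (1 + A))"
    unfolding bb by (simp add: algebra_simps power2_eq_square)
  finally have e: "(1 + A) * ((1 + A) * v - b * v') + b * ((1 + A) * v' - b' * v) = v * (2 * (1 + A))" .
  have "2 * (1 + A) \<noteq> 0" using nz by (metis mult_eq_0_iff zero_neq_numeral)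
  then show 1: "(1 + A) * (((1 + A) * v - b * v') / (2 * (1 + A))) +
      b * (((1 + A) * v' - b' * v) / (2 * (1 + A))) = v"
    unfolding times_divide_eq_right add_divide_distrib[symmetric] e
    by (rule nonzero_mult_div_cancel_right)
  define B where "B = 1 + A"
  define g g' where "g = (B * v - b * v') / (2 * B)" and "g' = (B * v' - b' * v) / (2 * B)"
  have v: "B * g + b * g' = v"
    using 1 unfolding g_def g'_def B_def .
  have two: "2 * (x / (2 * B)) = x / B" for x by simp
  have "g - (A * g + b * g') = 2 * g - (B * g + b * g')"
    unfolding B_def by (simp add: algebra_simps)
  also have "\<dots> = (B * v - b * v') / B - v"
    unfolding v unfolding g_def two ..
  also have "\<dots> = - b * v' / B"
    using nz unfolding B_def[symmetric] diff_divide_distrib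
    by (simp only: nonzero_mult_div_cancel_left mult_minus_left minus_divide_left) simp
  finally show "((1 + A) * v - b * v') / (2 * (1 + A)) -
      (A * (((1 + A) * v - b * v') / (2 * (1 + A))) + b * (((1 + A) * v' - b' * v) / (2 * (1 + A)))) =
      - b * v' / (1 + A)"
    unfolding g_def g'_def B_def .
qed

text \<open>If \<open>P\<close> is the gradient of a convex solution of the Monge-Ampere equation with right-hand side 1, then
  \<open>w + P w\<close> is a coordinate, because \<open>P\<close> is monotone, and in this coordinate the conjugate of
  \<open>w - P w\<close> is a holomorphic function \<open>H\<close>.  Its derivative \<open>- cnj \<beta> / (1 + \<alpha>)\<close> satisfies
  \<open>\<bar>H'\<bar>\<^sup>2 = (\<alpha> - 1) / (\<alpha> + 1) < 1\<close>.\<close>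

lemma Lewy_transform:
  fixes P :: "complex \<Rightarrow> complex" and \<alpha> :: "complex \<Rightarrow> real"
  assumes D: "convex D" "open D"
    and dP: "\<And>w. w \<in> D \<Longrightarrow> (P has_derivative (\<lambda>z. of_real (\<alpha> w) * z + \<beta> w * cnj z)) (at w)"
    and det: "\<And>w. w \<in> D \<Longrightarrow> (\<alpha> w)\<^sup>2 - (cmod (\<beta> w))\<^sup>2 = 1" "\<And>w. w \<in> D \<Longrightarrow> \<alpha> w > 0"
  obtains H where "open ((\<lambda>w. w + P w) ` D)" "H holomorphic_on (\<lambda>w. w + P w) ` D"
    "\<And>w. w \<in> D \<Longrightarrow> H (w + P w) = cnj (w - P w)"
    "\<And>w. w \<in> D \<Longrightarrow> cmod (deriv H (w + P w)) < 1"
proof -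
  define \<zeta> where "\<zeta> w = w + P w" for w
  have inj: "inj_on \<zeta> D"
  proof (rule inj_onI, rule ccontr)
    fix w w' assume w: "w \<in> D" "w' \<in> D" "\<zeta> w = \<zeta> w'" "w \<noteq> w'"
    have "P w' - P w = (\<zeta> w' - \<zeta> w) - (w' - w)" by (simp add: \<zeta>_def)
    then have eq: "P w' - P w = - (w' - w)" using w(3) by simp
    have "Re (cnj (w' - w) * (- (w' - w))) > 0"
      using gradient_strictly_monotone[OF D(1) dP det w(1,2,4)] unfolding eq .
    moreover have "Re (cnj d * (- d)) \<le> 0" for d
    proof -
      have "Re (cnj d * (- d)) = - (cmod d)\<^sup>2"
        unfolding cmod_power2 by (simp add: power2_eq_square)
      then show ?thesis by simp
    qed
    ultimately show False by (metis not_less)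
  qed
  have d\<zeta>: "(\<zeta> has_derivative (\<lambda>z. of_real (1 + \<alpha> w) * z + \<beta> w * cnj z)) (at w)" if "w \<in> D" for w
    unfolding \<zeta>_def using dP[OF that] by (auto intro!: derivative_eq_intros simp: algebra_simps)
  have cont: "continuous_on D \<zeta>"
    using d\<zeta> by (meson continuous_at_imp_continuous_on has_derivative_continuous)
  have op: "open (\<zeta> ` D)" by (rule invariance_of_domain[OF cont D(2) inj])
  define \<eta> where "\<eta> = inv_into D \<zeta>"
  have \<eta>: "\<eta> (\<zeta> w) = w" if "w \<in> D" for w
    using inj that by (simp add: \<eta>_def)
  define H where "H a = cnj (\<eta> a - P (\<eta> a))" for a
  have dH: "(H has_field_derivative (- cnj (\<beta> w) / of_real (1 + \<alpha> w))) (at (\<zeta> w))" if w: "w \<in> D" for w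
  proof -
    let ?a = "\<alpha> w" and ?b = "\<beta> w"
    let ?A = "complex_of_real (\<alpha> w)"
    define g where "g v = ((1 + ?A) * v - ?b * cnj v) / (2 * (1 + ?A))" for v
    have cg: "cnj (g v) = ((1 + ?A) * cnj v - cnj ?b * v) / (2 * (1 + ?A))" for v
      by (simp add: g_def)
    have "?b * cnj ?b = of_real ((cmod ?b)\<^sup>2)" by (rule complex_norm_square[symmetric])
    also have "(cmod ?b)\<^sup>2 = ?a\<^sup>2 - 1" using det(1)[OF w] by linarith
    finally have bb: "?b * cnj ?b = ?A\<^sup>2 - 1" by simp
    have "1 + ?a \<noteq> 0" using det(2)[OF w] by linarith
    then have nz: "1 + ?A \<noteq> 0" by (metis of_real_1 of_real_add of_real_eq_0_iff)
    have inv: "(\<lambda>z. of_real (1 + ?a) * z + ?b * cnj z) \<circ> g = id"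
      unfolding fun_eq_iff comp_def cg unfolding g_def of_real_add of_real_1
      using Lewy_differential_inverse(1)[OF bb nz] by simp
    have d\<eta>: "(\<eta> has_derivative g) (at (\<zeta> w))"
      by (rule has_derivative_inverse_strong[OF D(2) w cont \<eta> d\<zeta>[OF w] inv])
    have "(P has_derivative (\<lambda>z. of_real ?a * z + ?b * cnj z)) (at (\<eta> (\<zeta> w)))"
      using dP[OF w] \<eta>[OF w] by simp
    from has_derivative_compose[OF d\<eta> this]
    have "((\<lambda>a. P (\<eta> a)) has_derivative (\<lambda>v. of_real ?a * g v + ?b * cnj (g v))) (at (\<zeta> w))" .
    from has_derivative_cnj[OF has_derivative_diff[OF d\<eta> this]]
    have dHd: "(H has_derivative (\<lambda>v. cnj (g v - (of_real ?a * g v + ?b * cnj (g v))))) (at (\<zeta> w))"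
      unfolding H_def .
    have eq: "cnj (g v - (of_real ?a * g v + ?b * cnj (g v))) = - cnj ?b / of_real (1 + ?a) * v" for v
      unfolding cg unfolding g_def Lewy_differential_inverse(2)[OF bb nz] by simp
    show ?thesis using dHd unfolding eq has_field_derivative_def .
  qed
  show thesis
  proof (rule that[of H]; (fold \<zeta>_def)?)
    show "open (\<zeta> ` D)" by (rule op)
    show "H holomorphic_on \<zeta> ` D"
      unfolding holomorphic_on_open[OF op] using dH by blast
    show "H (\<zeta> w) = cnj (w - P w)" if "w \<in> D" for w
      using \<eta>[OF that] by (simp add: H_def)
    show "cmod (deriv H (\<zeta> w)) < 1" if w: "w \<in> D" for w
      using DERIV_imp_deriv[OF dH[OF w]] cmod_less_of_det[OF det(1,2)[OF w]] det(2)[OF w]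
      by (simp add: norm_divide del: of_real_add)
  qed
qed

section \<open>Polarisation\<close>

text \<open>The Lewy coordinate \<open>\<zeta> = w + P w\<close> determines \<open>w = (\<zeta> + cnj (H \<zeta>)) / 2\<close>.  Treating \<open>\<zeta>\<close> and its
  conjugate as independent variables \<open>a\<close> and \<open>b\<close> turns this formula and its conjugate into the
  holomorphic map \<open>T\<close> of two variables.  Since \<open>H\<close> and \<open>H'\<close> are contractions, \<open>T\<close> is injective
  and its differential, of determinant \<open>(1 - h a * h' b) / 4\<close>, is invertible.  Hence the inverse
  of \<open>T\<close> is holomorphic, and it expresses \<open>\<zeta>\<close> through \<open>w\<close> and \<open>cnj w\<close>.\<close>

lemma complexified_Legendre_inverse:
  fixes H H' :: "complex \<Rightarrow> complex"
  assumes H: "\<And>x. x \<in> ball a0 r \<Longrightarrow> (H has_field_derivative h x) (at x)"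
    and H': "\<And>y. y \<in> ball b0 r \<Longrightarrow> (H' has_field_derivative h' y) (at y)"
    and k: "\<And>x. x \<in> ball a0 r \<Longrightarrow> cmod (h x) \<le> k" "\<And>y. y \<in> ball b0 r \<Longrightarrow> cmod (h' y) \<le> k" "k < 1"
    and r: "r > 0"
  defines "T \<equiv> \<lambda>(a, b). ((a + H' b) / 2, (b + H a) / 2)"
  obtains S where "open (T ` (ball a0 r \<times> ball b0 r))"
    "\<And>p. p \<in> ball a0 r \<times> ball b0 r \<Longrightarrow> S (T p) = p"
    "holomorphic2_on (\<lambda>q. fst (S q)) (T ` (ball a0 r \<times> ball b0 r))"
    "holomorphic2_on (\<lambda>q. snd (S q)) (T ` (ball a0 r \<times> ball b0 r))"
proof -
  let ?D = "ball a0 r \<times> ball b0 r"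
  have op: "open ?D" by (intro open_Times) auto
  have k0: "0 \<le> k" using k(1)[of a0] r by (auto intro: order_trans[OF norm_ge_zero])
  have contr: "norm (H x - H y) \<le> k * norm (x - y)" if "x \<in> ball a0 r" "y \<in> ball a0 r" for x y
    by (rule field_differentiable_bound[OF convex_ball has_field_derivative_at_within[OF H] k(1)])
       (use that in auto)
  have contr': "norm (H' x - H' y) \<le> k * norm (x - y)" if "x \<in> ball b0 r" "y \<in> ball b0 r" for x y
    by (rule field_differentiable_bound[OF convex_ball has_field_derivative_at_within[OF H'] k(2)])
       (use that in auto)
  have inj: "inj_on T ?D"
  proof (rule inj_onI)
    fix p q assume p: "p \<in> ?D" and q: "q \<in> ?D" and eq: "T p = T q"
    obtain a b where pab: "p = (a, b)" by (cases p)
    obtain a' b' where qab: "q = (a', b')" by (cases q)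
    have "(a + H' b) / 2 = (a' + H' b') / 2" "(b + H a) / 2 = (b' + H a') / 2"
      using eq by (auto simp: T_def pab qab)
    moreover have "x = y" if "x / 2 = y / 2" for x y :: complex using that by simp
    ultimately have "a + H' b = a' + H' b'" "b + H a = b' + H a'"
      by blast+
    then have e: "a - a' = H' b' - H' b" "b' - b = H a - H a'"
      by algebra+
    have 1: "norm (a - a') \<le> k * norm (b' - b)"
      unfolding e(1) using contr'[of b' b] p q by (simp add: pab qab)
    have 2: "norm (b' - b) \<le> k * norm (a - a')"
      unfolding e(2) using contr[of a a'] p q by (simp add: pab qab)
    have *: "x = 0" if "x \<le> k * y" "y \<le> k * x" "x \<ge> 0" "y \<ge> 0" for x y :: real
    proof (rule ccontr)
      assume "x \<noteq> 0"
      then have "x > 0" using that by simp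
      have "k * y \<le> k * (k * x)" using that k0 by (intro mult_left_mono)
      also have "\<dots> \<le> 1 * (k * x)" using k0 k(3) \<open>x > 0\<close> by (intro mult_right_mono) auto
      finally have "x \<le> k * x" using that by simp
      then show False using k(3) \<open>x > 0\<close> by simp
    qed
    have "norm (a - a') = 0" using *[OF 1 2] by simp
    moreover have "norm (b' - b) = 0" using *[OF 2 1] by simp
    ultimately show "p = q" by (simp add: pab qab)
  qed
  have dT: "(T has_derivative (\<lambda>(x, y). ((x + h' b * y) / 2, (y + h a * x) / 2))) (at (a, b))"
    if ab: "(a, b) \<in> ?D" for a b
  proof -
    have "(H has_derivative (*) (h a)) (at (fst (a, b)))"
      using H[of a] ab by (simp add: has_field_derivative_def)
    then have 1: "((\<lambda>p. H (fst p)) has_derivative (\<lambda>z. h a * fst z)) (at (a, b))"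
      by (rule has_derivative_compose[OF has_derivative_fst[OF has_derivative_ident]])
    have "(H' has_derivative (*) (h' b)) (at (snd (a, b)))"
      using H'[of b] ab by (simp add: has_field_derivative_def)
    then have 2: "((\<lambda>p. H' (snd p)) has_derivative (\<lambda>z. h' b * snd z)) (at (a, b))"
      by (rule has_derivative_compose[OF has_derivative_snd[OF has_derivative_ident]])
    have "((\<lambda>p. ((fst p + H' (snd p)) / 2, (snd p + H (fst p)) / 2)) has_derivative
        (\<lambda>z. ((fst z + h' b * snd z) / 2, (snd z + h a * fst z) / 2))) (at (a, b))"
      by (intro has_derivative_Pair bounded_linear.has_derivative[OF bounded_linear_divide] has_derivative_add
          has_derivative_fst has_derivative_snd has_derivative_ident 1 2)
    then show ?thesis by (simp add: T_def case_prod_unfold)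
  qed
  have cont: "continuous_on ?D T"
  proof (rule continuous_at_imp_continuous_on, rule ballI)
    show "isCont T p" if "p \<in> ?D" for p
      using has_derivative_continuous[OF dT[of "fst p" "snd p"]] that by simp
  qed
  have opT: "open (T ` ?D)" by (rule invariance_of_domain[OF cont op inj])
  define S where "S = inv_into ?D T"
  have S: "S (T p) = p" if "p \<in> ?D" for p
    using inj that by (simp add: S_def)
  have dS: "\<exists>m. (S has_derivative (\<lambda>(u, v). (2 * (u - h' (snd p) * v) / m, 2 * (v - h (fst p) * u) / m))) (at (T p))"
    if p: "p \<in> ?D" for p
  proof -
    obtain a b where pab: "p = (a, b)" by (cases p)
    define m where "m = 1 - h a * h' b"
    have "cmod (h a * h' b) \<le> k * k"
      unfolding norm_mult using p k0 by (intro mult_mono k) (auto simp: pab)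
    also have "\<dots> \<le> k * 1" using k0 k(3) by (intro mult_left_mono) auto
    also have "\<dots> < 1" using k(3) by simp
    finally have m: "m \<noteq> 0" unfolding m_def by auto
    define g where "g = (\<lambda>(u, v). (2 * (u - h' b * v) / m, 2 * (v - h a * u) / m))"
    have "(\<lambda>(x, y). ((x + h' b * y) / 2, (y + h a * x) / 2)) \<circ> g = id"
    proof
      fix z :: "complex \<times> complex"
      obtain u v where z: "z = (u, v)" by (cases z)
      have *: "(2 * x / m + c * (2 * y / m)) / 2 = (x + c * y) / m" for x y c
        by (simp add: add_divide_distrib)
      have e1: "u - h' b * v + h' b * (v - h a * u) = u * m"
        by (simp add: m_def algebra_simps)
      have e2: "v - h a * u + h a * (u - h' b * v) = v * m"
        by (simp add: m_def algebra_simps)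
      show "((\<lambda>(x, y). ((x + h' b * y) / 2, (y + h a * x) / 2)) \<circ> g) z = id z"
        unfolding z g_def comp_def prod.case * e1 e2 using m by simp
    qed
    from has_derivative_inverse_strong[OF op p cont S _ this] dT[of a b] p
    have "(S has_derivative g) (at (T p))" by (simp add: pab)
    then show ?thesis unfolding g_def pab by auto
  qed
  show thesis
  proof (rule that[of S])
    show "holomorphic2_on (\<lambda>q. fst (S q)) (T ` ?D)"
      unfolding holomorphic2_on_def
    proof
      fix q assume "q \<in> T ` ?D"
      then obtain p where p: "p \<in> ?D" "q = T p" by blast
      obtain m where "(S has_derivative (\<lambda>(u, v). (2 * (u - h' (snd p) * v) / m, 2 * (v - h (fst p) * u) / m))) (at q)"
        using dS[OF p(1)] p(2) by blast
      from has_derivative_fst[OF this]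
      have "((\<lambda>q. fst (S q)) has_derivative (\<lambda>(u, v). 2 / m * u + - (2 * h' (snd p) / m) * v)) (at q)"
        by (simp add: case_prod_unfold algebra_simps diff_divide_distrib)
      then show "\<exists>c d. ((\<lambda>q. fst (S q)) has_derivative (\<lambda>(x, y). c * x + d * y)) (at q)" by blast
    qed
    show "holomorphic2_on (\<lambda>q. snd (S q)) (T ` ?D)"
      unfolding holomorphic2_on_def
    proof
      fix q assume "q \<in> T ` ?D"
      then obtain p where p: "p \<in> ?D" "q = T p" by blast
      obtain m where "(S has_derivative (\<lambda>(u, v). (2 * (u - h' (snd p) * v) / m, 2 * (v - h (fst p) * u) / m))) (at q)"
        using dS[OF p(1)] p(2) by blast
      from has_derivative_snd[OF this]
      have "((\<lambda>q. snd (S q)) has_derivative (\<lambda>(u, v). - (2 * h (fst p) / m) * u + 2 / m * v)) (at q)"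
        by (simp add: case_prod_unfold algebra_simps diff_divide_distrib)
      then show "\<exists>c d. ((\<lambda>q. snd (S q)) has_derivative (\<lambda>(x, y). c * x + d * y)) (at q)" by blast
    qed
  qed (use opT S in auto)
qed

text \<open>The potential is recovered from the Lewy coordinate \<open>\<zeta>\<close>: if \<open>G\<close> is a primitive of \<open>H\<close>, then up to a
  constant \<open>\<Phi> w = Re (\<zeta> * cnj w) - \<bar>w\<bar>\<^sup>2 / 2 - \<bar>\<zeta>\<bar>\<^sup>2 / 4 - Re (G \<zeta>) / 2\<close>, as one sees by
  differentiating and inserting \<open>H \<zeta> = 2 cnj w - cnj \<zeta>\<close>.  By polarisation the right-hand side is the
  restriction to \<open>(w, cnj w)\<close> of a holomorphic function of two variables, and the linear substitution
  \<open>w = x + \<i> y\<close>, \<open>cnj w = x - \<i> y\<close> with complex \<open>x\<close> and \<open>y\<close> yields the double power series.\<close>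

lemma Monge_Ampere_double_power_series:
  fixes \<Phi> :: "complex \<Rightarrow> real" and P :: "complex \<Rightarrow> complex" and \<alpha> :: "complex \<Rightarrow> real"
  assumes D: "open D" "w0 \<in> D"
    and d\<Phi>: "\<And>w. w \<in> D \<Longrightarrow> (\<Phi> has_derivative (\<lambda>z. Re (cnj (P w) * z))) (at w)"
    and dP: "\<And>w. w \<in> D \<Longrightarrow> (P has_derivative (\<lambda>z. of_real (\<alpha> w) * z + \<beta> w * cnj z)) (at w)"
    and det: "\<And>w. w \<in> D \<Longrightarrow> (\<alpha> w)\<^sup>2 - (cmod (\<beta> w))\<^sup>2 = 1" "\<And>w. w \<in> D \<Longrightarrow> \<alpha> w > 0"
  obtains r :: real and c :: "nat \<times> nat \<Rightarrow> real" where "r > 0" "\<And>w. w \<in> ball w0 r \<Longrightarrow>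
     ((\<lambda>(i, j). c (i, j) * (Re w - Re w0) ^ i * (Im w - Im w0) ^ j) has_sum \<Phi> w) UNIV"
proof -
  define \<zeta> where "\<zeta> w = w + P w" for w
  obtain R where R: "R > 0" "ball w0 R \<subseteq> D"
    using D open_contains_ball by blast
  define \<Omega> where "\<Omega> = \<zeta> ` ball w0 R"
  obtain H where op: "open \<Omega>" and hol: "H holomorphic_on \<Omega>"
    and H\<zeta>: "\<And>w. w \<in> ball w0 R \<Longrightarrow> H (\<zeta> w) = cnj (w - P w)"
    and H1: "\<And>w. w \<in> ball w0 R \<Longrightarrow> cmod (deriv H (\<zeta> w)) < 1"
  proof (rule Lewy_transform[of "ball w0 R" P \<alpha> \<beta>])
    fix H assume "open ((\<lambda>w. w + P w) ` ball w0 R)" "H holomorphic_on (\<lambda>w. w + P w) ` ball w0 R"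
      "\<And>w. w \<in> ball w0 R \<Longrightarrow> H (w + P w) = cnj (w - P w)"
      "\<And>w. w \<in> ball w0 R \<Longrightarrow> cmod (deriv H (w + P w)) < 1"
    then show thesis by (intro that[of H]) (simp_all only: \<Omega>_def \<zeta>_def[abs_def])
  qed (use R(2) dP det in auto)
  have \<zeta>0: "\<zeta> w0 \<in> \<Omega>" using R by (simp add: \<Omega>_def)
  \<comment> \<open>A contraction constant that is strictly between the derivative at the centre and 1.\<close>
  define k where "k = (1 + cmod (deriv H (\<zeta> w0))) / 2"
  have k: "k < 1" "cmod (deriv H (\<zeta> w0)) < k" using H1[of w0] R by (auto simp: k_def)
  obtain \<rho> where \<rho>: "\<rho> > 0" "\<And>x. x \<in> ball (\<zeta> w0) \<rho> \<Longrightarrow> x \<in> \<Omega> \<and> cmod (deriv H x) \<le> k"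
  proof -
    have "continuous_on \<Omega> (\<lambda>x. cmod (deriv H x))"
      by (intro continuous_intros holomorphic_on_imp_continuous_on holomorphic_deriv hol op)
    then have "open (\<Omega> \<inter> (\<lambda>x. cmod (deriv H x)) -` {..<k})"
      using op by (intro continuous_open_preimage) auto
    moreover have "\<zeta> w0 \<in> \<Omega> \<inter> (\<lambda>x. cmod (deriv H x)) -` {..<k}"
      using \<zeta>0 k by simp
    ultimately obtain \<rho> where "\<rho> > 0" "ball (\<zeta> w0) \<rho> \<subseteq> \<Omega> \<inter> (\<lambda>x. cmod (deriv H x)) -` {..<k}"
      using open_contains_ball by blast
    then show thesis using that[of \<rho>] by force
  qed
  let ?B = "ball (\<zeta> w0) \<rho>" and ?B' = "ball (cnj (\<zeta> w0)) \<rho>"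
  have cB: "cnj b \<in> ?B \<longleftrightarrow> b \<in> ?B'" for b
    by (metis complex_cnj_cnj complex_mod_cnj complex_cnj_diff dist_norm mem_ball)
  have dH: "(H has_field_derivative deriv H x) (at x)" if "x \<in> ?B" for x
    using \<rho>(2)[OF that] by (intro holomorphic_derivI[OF hol op]) auto
  obtain G where G: "\<And>x. x \<in> ?B \<Longrightarrow> (G has_field_derivative H x) (at x)"
  proof -
    have "H holomorphic_on ?B" using hol \<rho>(2) by (meson holomorphic_on_subset subsetI)
    then obtain G where "\<And>x. x \<in> ?B \<Longrightarrow> (G has_field_derivative H x) (at x within ?B)"
      using holomorphic_convex_primitive'[of ?B H] by auto
    then show thesis using that[of G] by (simp add: at_within_open[OF _ open_ball])
  qed
  define H' G' where "H' = cnj \<circ> H \<circ> cnj" and "G' = cnj \<circ> G \<circ> cnj"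
  have dH': "(H' has_field_derivative cnj (deriv H (cnj y))) (at y)" if "y \<in> ?B'" for y
    unfolding H'_def using dH[of "cnj y"] that cB by (intro has_field_derivative_cnj_cnj) auto
  have dG': "(G' has_field_derivative cnj (H (cnj y))) (at y)" if "y \<in> ?B'" for y
    unfolding G'_def using G[of "cnj y"] that cB by (intro has_field_derivative_cnj_cnj) auto
  define T where "T = (\<lambda>(a, b). ((a + H' b) / 2, (b + H a) / 2))"
  obtain S where V: "open (T ` (?B \<times> ?B'))" and S: "\<And>p. p \<in> ?B \<times> ?B' \<Longrightarrow> S (T p) = p"
    and S1: "holomorphic2_on (\<lambda>q. fst (S q)) (T ` (?B \<times> ?B'))"
    and S2: "holomorphic2_on (\<lambda>q. snd (S q)) (T ` (?B \<times> ?B'))"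
  proof (rule complexified_Legendre_inverse[OF dH dH' _ _ k(1) \<rho>(1)])
    show "cmod (deriv H x) \<le> k" if "x \<in> ?B" for x using \<rho>(2)[OF that] by simp
    show "cmod (cnj (deriv H (cnj y))) \<le> k" if "y \<in> ?B'" for y
      using \<rho>(2)[of "cnj y"] that cB by simp
  qed (auto simp: T_def)
  define V where "V = T ` (?B \<times> ?B')"
  \<comment> \<open>The polarised formula for \<open>\<Phi>\<close>: at \<open>q = (w, cnj w)\<close> one has \<open>S q = (\<zeta> w, cnj (\<zeta> w))\<close>.\<close>
  define E where "E q = (fst (S q) * snd q + fst q * snd (S q)) * (1/2) - fst q * snd q * (1/2)
    - fst (S q) * snd (S q) * (1/4) - (G (fst (S q)) + G' (snd (S q))) * (1/4)" for q
  have E: "holomorphic2_on E V"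
  proof -
    have mem: "fst (S q) \<in> ?B" "snd (S q) \<in> ?B'" if "q \<in> V" for q
      using that S unfolding V_def by force+
    have hG: "G holomorphic_on ?B" "G' holomorphic_on ?B'"
      unfolding holomorphic_on_open[OF open_ball] using G dG' by blast+
    have 1: "holomorphic2_on (\<lambda>q. G (fst (S q))) V"
      by (rule holomorphic2_on_compose[OF hG(1) open_ball S1[folded V_def] mem(1)])
    have 2: "holomorphic2_on (\<lambda>q. G' (snd (S q))) V"
      by (rule holomorphic2_on_compose[OF hG(2) open_ball S2[folded V_def] mem(2)])
    show ?thesis
      unfolding E_def by (intro holomorphic2_intros S1[folded V_def] S2[folded V_def] 1 2)
  qed
  have cont\<zeta>: "isCont \<zeta> w" if "w \<in> ball w0 R" for w
    unfolding \<zeta>_def using has_derivative_continuous[OF dP] that R by (intro continuous_intros) auto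
  obtain s where s: "s > 0" "ball w0 s \<subseteq> ball w0 R" "\<And>w. w \<in> ball w0 s \<Longrightarrow> \<zeta> w \<in> ?B"
  proof -
    obtain d where "d > 0" "\<And>w. dist w w0 < d \<Longrightarrow> dist (\<zeta> w) (\<zeta> w0) < \<rho>"
      using cont\<zeta>[of w0] R \<rho>(1) unfolding continuous_at_eps_delta by (metis centre_in_ball)
    then show thesis by (intro that[of "min d R"]) (use R in \<open>auto simp: dist_commute\<close>)
  qed
  have T\<zeta>: "T (\<zeta> w, cnj (\<zeta> w)) = (w, cnj w)" "(\<zeta> w, cnj (\<zeta> w)) \<in> ?B \<times> ?B'" if "w \<in> ball w0 s" for w
  proof -
    have "H (\<zeta> w) = cnj (w - P w)" using H\<zeta> that s(2) by blast
    then show "T (\<zeta> w, cnj (\<zeta> w)) = (w, cnj w)" by (simp add: T_def H'_def \<zeta>_def)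
    show "(\<zeta> w, cnj (\<zeta> w)) \<in> ?B \<times> ?B'" using s(3)[OF that] cB[of "cnj (\<zeta> w)"] by simp
  qed
  have ReE: "Re (E (w, cnj w)) = Re (\<zeta> w * cnj w) - Re (w * cnj w) / 2 - Re (\<zeta> w * cnj (\<zeta> w)) / 4
      - Re (G (\<zeta> w)) / 2" if w: "w \<in> ball w0 s" for w
  proof -
    have "S (w, cnj w) = (\<zeta> w, cnj (\<zeta> w))" using S[OF T\<zeta>(2)[OF w]] T\<zeta>(1)[OF w] by simp
    then show ?thesis by (simp add: E_def G'_def)
  qed
  have dE: "((\<lambda>w. Re (E (w, cnj w))) has_derivative (\<lambda>z. Re (cnj (P w) * z))) (at w)"
    if w: "w \<in> ball w0 s" for w
  proof -
    have wR: "w \<in> ball w0 R" "w \<in> D" using w s R by auto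
    define \<zeta>' where "\<zeta>' z = z + (of_real (\<alpha> w) * z + \<beta> w * cnj z)" for z
    have d\<zeta>: "(\<zeta> has_derivative \<zeta>') (at w)"
      unfolding \<zeta>_def \<zeta>'_def by (intro has_derivative_add has_derivative_ident dP wR)
    have dG: "((\<lambda>w. G (\<zeta> w)) has_derivative (\<lambda>z. H (\<zeta> w) * \<zeta>' z)) (at w)"
      by (rule has_derivative_compose[OF d\<zeta> has_field_derivative_imp_has_derivative[OF G[OF s(3)[OF w]]]])
    have Hw: "H (\<zeta> w) = 2 * cnj w - cnj (\<zeta> w)"
      using H\<zeta>[OF wR(1)] by (simp add: \<zeta>_def)
    have "((\<lambda>w. Re (\<zeta> w * cnj w) - Re (w * cnj w) / 2 - Re (\<zeta> w * cnj (\<zeta> w)) / 4 - Re (G (\<zeta> w)) / 2)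
       has_derivative (\<lambda>z. Re (\<zeta> w * cnj z + \<zeta>' z * cnj w) - Re (w * cnj z + z * cnj w) / 2
         - Re (\<zeta> w * cnj (\<zeta>' z) + \<zeta>' z * cnj (\<zeta> w)) / 4 - Re (H (\<zeta> w) * \<zeta>' z) / 2)) (at w)"
      by (intro has_derivative_diff has_derivative_Re has_derivative_mult has_derivative_cnj
          bounded_linear.has_derivative[OF bounded_linear_divide] has_derivative_ident d\<zeta> dG)
    also have "(\<lambda>z. Re (\<zeta> w * cnj z + \<zeta>' z * cnj w) - Re (w * cnj z + z * cnj w) / 2
         - Re (\<zeta> w * cnj (\<zeta>' z) + \<zeta>' z * cnj (\<zeta> w)) / 4 - Re (H (\<zeta> w) * \<zeta>' z) / 2)
         = (\<lambda>z. Re (cnj (\<zeta> w - w) * z))"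
      unfolding Hw by (simp add: fun_eq_iff field_simps)
    also have "\<zeta> w - w = P w" by (simp add: \<zeta>_def)
    finally show ?thesis
    proof (rule has_derivative_transform_within_open[OF _ open_ball w])
      show "\<And>w. w \<in> ball w0 s \<Longrightarrow> Re (\<zeta> w * cnj w) - Re (w * cnj w) / 2 - Re (\<zeta> w * cnj (\<zeta> w)) / 4
        - Re (G (\<zeta> w)) / 2 = Re (E (w, cnj w))"
        using ReE by simp
    qed
  qed
  have "\<exists>C. \<forall>w\<in>ball w0 s. \<Phi> w - Re (E (w, cnj w)) = C"
  proof (rule has_derivative_zero_constant[OF convex_ball])
    fix w assume w: "w \<in> ball w0 s"
    then have "w \<in> D" using s R by auto
    from has_derivative_diff[OF d\<Phi>[OF this] dE[OF w]]
    show "((\<lambda>w. \<Phi> w - Re (E (w, cnj w))) has_derivative (\<lambda>h. 0)) (at w within ball w0 s)"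
      by (simp add: has_derivative_at_withinI)
  qed
  then obtain C where C: "\<And>w. w \<in> ball w0 s \<Longrightarrow> \<Phi> w = Re (E (w, cnj w) + of_real C)"
    by (metis Re_complex_of_real add.commute diff_add_cancel plus_complex.sel(1))
  define L :: "complex \<times> complex \<Rightarrow> complex \<times> complex"
    where "L q = (fst q + \<i> * snd q, fst q - \<i> * snd q)" for q
  define Q where "Q q = E (L q) + of_real C" for q
  have Lw: "L (of_real (Re w), of_real (Im w)) = (w, cnj w)" for w
    by (simp add: L_def complex_eq_iff)
  have opL: "open (L -` V)"
    unfolding L_def by (intro open_vimage V[folded V_def] continuous_intros)
  have memL: "(of_real (Re w0), of_real (Im w0)) \<in> L -` V"
    using T\<zeta>[of w0] s(1) Lw[of w0] unfolding V_def by (metis centre_in_ball image_eqI vimageI)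
  have holQ: "holomorphic2_on Q (L -` V)"
    unfolding Q_def L_def
    by (intro holomorphic2_on_add holomorphic2_on_const holomorphic2_on_compose2[OF E] holomorphic2_intros) auto
  obtain r c where r: "r > 0"
    and c: "\<And>x y. x \<in> ball (of_real (Re w0)) r \<Longrightarrow> y \<in> ball (of_real (Im w0)) r \<Longrightarrow>
     ((\<lambda>(i, j). c (i, j) * (x - of_real (Re w0)) ^ i * (y - of_real (Im w0)) ^ j) has_sum Q (x, y)) UNIV"
  proof (rule holomorphic2_on_imp_double_power_series[OF holQ opL memL])
    fix r :: real and c :: "nat \<times> nat \<Rightarrow> complex"
    assume r: "r > 0"
      and c: "\<And>x y. x \<in> ball (of_real (Re w0)) r \<Longrightarrow> y \<in> ball (of_real (Im w0)) r \<Longrightarrow>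
        ((\<lambda>(i, j). c (i, j) * (x - of_real (Re w0)) ^ i * (y - of_real (Im w0)) ^ j) has_sum Q (x, y)) UNIV"
    show thesis by (rule that[OF r c])
  qed
  show thesis
  proof (rule that[of "min r s" "\<lambda>p. Re (c p)"])
    show "min r s > 0" using r s by simp
    fix w assume w: "w \<in> ball w0 (min r s)"
    have "\<bar>Re w0 - Re w\<bar> < r" "\<bar>Im w0 - Im w\<bar> < r"
      using w abs_Re_le_cmod[of "w0 - w"] abs_Im_le_cmod[of "w0 - w"] by (auto simp: dist_norm)
    then have "complex_of_real (Re w) \<in> ball (of_real (Re w0)) r" "complex_of_real (Im w) \<in> ball (of_real (Im w0)) r"
      by (auto simp: dist_norm simp flip: of_real_diff)
    from has_sum_Re[OF c[OF this]]
    have "((\<lambda>p. Re (case p of (i, j) \<Rightarrow> c (i, j) * (of_real (Re w) - of_real (Re w0)) ^ i *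
        (of_real (Im w) - of_real (Im w0)) ^ j)) has_sum Re (Q (of_real (Re w), of_real (Im w)))) UNIV" .
    moreover have "Re (Q (of_real (Re w), of_real (Im w))) = \<Phi> w"
      using C[of w] w unfolding Q_def Lw by simp
    moreover have "Re (case p of (i, j) \<Rightarrow> c (i, j) * (of_real (Re w) - of_real (Re w0)) ^ i *
        (of_real (Im w) - of_real (Im w0)) ^ j) =
      (case p of (i, j) \<Rightarrow> Re (c (i, j)) * (Re w - Re w0) ^ i * (Im w - Im w0) ^ j)" for p
      unfolding of_real_diff[symmetric] of_real_power[symmetric]
      by (simp add: case_prod_unfold del: of_real_diff of_real_power)
    ultimately show "((\<lambda>(i, j). Re (c (i, j)) * (Re w - Re w0) ^ i * (Im w - Im w0) ^ j) has_sum \<Phi> w) UNIV"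
      by simp
  qed
qed

text \<open>The passage from real matrices to the complex notation: a symmetric matrix with entries \<open>r, s, t\<close>
  acts as \<open>z \<mapsto> \<alpha> z + \<beta> cnj z\<close> with \<open>\<alpha> = (r + t) / 2\<close> and \<open>\<beta> = (r - t) / 2 + \<i> s\<close>.\<close>

theorem Monge_Ampere_imp_real_analytic:
  fixes \<Psi> :: "real^2 \<Rightarrow> real" and P :: "real^2 \<Rightarrow> real^2" and B :: "real^2 \<Rightarrow> real^2^2"
  assumes W: "open W"
    and d\<Psi>: "\<And>x. x \<in> W \<Longrightarrow> (\<Psi> has_derivative (\<lambda>v. P x \<bullet> v)) (at x)"
    and dP: "\<And>x. x \<in> W \<Longrightarrow> (P has_derivative (\<lambda>v. B x *v v)) (at x)"
    and sym: "\<And>x. x \<in> W \<Longrightarrow> B x $ 1 $ 2 = B x $ 2 $ 1"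
    and det: "\<And>x. x \<in> W \<Longrightarrow> det (B x) = 1"
    and pos: "\<And>x. x \<in> W \<Longrightarrow> B x $ 1 $ 1 > 0"
  shows "real_analytic_on W \<Psi>"
  unfolding real_analytic_on_def
proof
  fix a assume a: "a \<in> W"
  define to_c :: "real^2 \<Rightarrow> complex" where "to_c x = Complex (x $ 1) (x $ 2)" for x
  define of_c :: "complex \<Rightarrow> real^2" where "of_c w = vector [Re w, Im w]" for w
  have of_to: "of_c (to_c x) = x" for x
    by (simp add: of_c_def to_c_def vec_eq_iff forall_2)
  have lin_of: "bounded_linear of_c"
    unfolding linear_conv_bounded_linear[symmetric] by (rule linearI) (simp_all add: of_c_def vec_eq_iff forall_2)
  have lin_to: "bounded_linear to_c"
    unfolding linear_conv_bounded_linear[symmetric] by (rule linearI) (simp_all add: to_c_def complex_eq_iff)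
  have d_of: "(of_c has_derivative of_c) (at w)" for w
    using lin_of by (rule bounded_linear_imp_has_derivative)
  have dist_to: "dist (to_c x) (to_c y) = dist x y" for x y
    by (simp add: dist_norm to_c_def cmod_def norm_vec_def L2_set_def sum_2)
  define \<alpha> where "\<alpha> w = (B (of_c w) $ 1 $ 1 + B (of_c w) $ 2 $ 2) / 2" for w
  define \<beta> where "\<beta> w = Complex ((B (of_c w) $ 1 $ 1 - B (of_c w) $ 2 $ 2) / 2) (B (of_c w) $ 1 $ 2)" for w
  define D where "D = of_c -` W"
  have det': "B x $ 1 $ 1 * B x $ 2 $ 2 - (B x $ 1 $ 2)\<^sup>2 = 1" if "x \<in> W" for x
    using det[OF that] sym[OF that] by (simp add: det_2 power2_eq_square)
  have D: "open D"
    unfolding D_def using W linear_continuous_on[OF lin_of, of UNIV] by (intro open_vimage) auto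
  have d\<Phi>: "((\<lambda>w. \<Psi> (of_c w)) has_derivative (\<lambda>z. Re (cnj (to_c (P (of_c w))) * z))) (at w)" if "w \<in> D" for w
  proof -
    have "((\<lambda>w. \<Psi> (of_c w)) has_derivative (\<lambda>z. P (of_c w) \<bullet> of_c z)) (at w)"
      using that by (intro has_derivative_compose[OF d_of d\<Psi>]) (simp add: D_def)
    moreover have "P (of_c w) \<bullet> of_c z = Re (cnj (to_c (P (of_c w))) * z)" for z
      by (simp add: to_c_def of_c_def inner_vec_def sum_2)
    ultimately show ?thesis by simp
  qed
  have dQ: "((\<lambda>w. to_c (P (of_c w))) has_derivative (\<lambda>z. of_real (\<alpha> w) * z + \<beta> w * cnj z)) (at w)"
    if "w \<in> D" for w
  proof -
    have "((\<lambda>w. P (of_c w)) has_derivative (\<lambda>z. B (of_c w) *v of_c z)) (at w)"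
      using that by (intro has_derivative_compose[OF d_of dP]) (simp add: D_def)
    then have "((\<lambda>w. to_c (P (of_c w))) has_derivative (\<lambda>z. to_c (B (of_c w) *v of_c z))) (at w)"
      by (rule bounded_linear.has_derivative[OF lin_to])
    moreover have "to_c (B (of_c w) *v of_c z) = of_real (\<alpha> w) * z + \<beta> w * cnj z" for z
      using sym[of "of_c w"] that
      by (simp add: complex_eq_iff to_c_def of_c_def \<alpha>_def \<beta>_def matrix_vector_mult_def sum_2 D_def field_simps)
    ultimately show ?thesis by simp
  qed
  have det\<alpha>: "(\<alpha> w)\<^sup>2 - (cmod (\<beta> w))\<^sup>2 = 1" if "w \<in> D" for w
    using det'[of "of_c w"] that
    unfolding cmod_power2 by (simp add: D_def \<alpha>_def \<beta>_def field_simps power2_eq_square)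
  have pos\<alpha>: "\<alpha> w > 0" if "w \<in> D" for w
  proof -
    have w: "of_c w \<in> W" using that by (simp add: D_def)
    have "B (of_c w) $ 1 $ 1 * B (of_c w) $ 2 $ 2 > 0"
      using det'[OF w] by (smt (verit) zero_le_power2)
    then have "B (of_c w) $ 2 $ 2 > 0" using pos[OF w] by (simp add: zero_less_mult_iff)
    then show ?thesis using pos[OF w] by (simp add: \<alpha>_def)
  qed
  have aD: "to_c a \<in> D" using a by (simp add: D_def of_to)
  show "\<exists>r>0. \<exists>c :: nat \<times> nat \<Rightarrow> real. \<forall>x\<in>ball a r.
        ((\<lambda>(i, j). c (i, j) * (x$1 - a$1) ^ i * (x$2 - a$2) ^ j) has_sum \<Psi> x) UNIV"
  proof (rule Monge_Ampere_double_power_series[OF D aD d\<Phi> dQ det\<alpha> pos\<alpha>])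
    fix r :: real and c :: "nat \<times> nat \<Rightarrow> real"
    assume r: "r > 0" and c: "\<And>w. w \<in> ball (to_c a) r \<Longrightarrow>
      ((\<lambda>(i, j). c (i, j) * (Re w - Re (to_c a)) ^ i * (Im w - Im (to_c a)) ^ j) has_sum \<Psi> (of_c w)) UNIV"
    have "((\<lambda>(i, j). c (i, j) * (x$1 - a$1) ^ i * (x$2 - a$2) ^ j) has_sum \<Psi> x) UNIV" if "x \<in> ball a r" for x
      using c[of "to_c x"] that unfolding of_to by (simp add: dist_to) (simp add: to_c_def)
    then show ?thesis using r by blast
  qed
qed

section \<open>Symmetry of second derivatives\<close>

lemma second_difference_mean_value:
  fixes f :: "'a::real_normed_vector \<Rightarrow> real"
  assumes s: "s > 0"
    and S: "\<And>a b. 0 \<le> a \<Longrightarrow> a \<le> s \<Longrightarrow> 0 \<le> b \<Longrightarrow> b \<le> s \<Longrightarrow> x + a *\<^sub>R u + b *\<^sub>R v \<in> S"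
    and fu: "\<And>y. y \<in> S \<Longrightarrow> ((\<lambda>t. f (y + t *\<^sub>R u)) has_real_derivative fu y) (at 0)"
    and fuv: "\<And>y. y \<in> S \<Longrightarrow> ((\<lambda>t. fu (y + t *\<^sub>R v)) has_real_derivative fuv y) (at 0)"
  obtains a b where "0 < a" "a < s" "0 < b" "b < s"
    "f (x + s *\<^sub>R u + s *\<^sub>R v) - f (x + s *\<^sub>R u) - f (x + s *\<^sub>R v) + f x = s * (s * fuv (x + a *\<^sub>R u + b *\<^sub>R v))"
proof -
  have shift: "((\<lambda>t. g (z + t *\<^sub>R w)) has_real_derivative g' (z + a *\<^sub>R w)) (at a)"
    if "((\<lambda>t. g (z + a *\<^sub>R w + t *\<^sub>R w)) has_real_derivative g' (z + a *\<^sub>R w)) (at 0)"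
    for g g' :: "'a \<Rightarrow> real" and z w a
    using DERIV_shift[of "\<lambda>t. g (z + t *\<^sub>R w)" "g' (z + a *\<^sub>R w)" 0 a] that
    by (simp add: scaleR_left_distrib add_ac)
  have d1: "((\<lambda>t. f (x + s *\<^sub>R v + t *\<^sub>R u) - f (x + t *\<^sub>R u)) has_real_derivative
      fu (x + s *\<^sub>R v + a *\<^sub>R u) - fu (x + a *\<^sub>R u)) (at a)" if "0 \<le> a" "a \<le> s" for a
  proof (rule DERIV_diff)
    have m: "x + s *\<^sub>R v + a *\<^sub>R u \<in> S" "x + a *\<^sub>R u \<in> S"
      using S[of a s] S[of a 0] that s by (simp_all add: add_ac)
    show "((\<lambda>t. f (x + s *\<^sub>R v + t *\<^sub>R u)) has_real_derivative fu (x + s *\<^sub>R v + a *\<^sub>R u)) (at a)"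
      by (rule shift, rule fu, rule m)
    show "((\<lambda>t. f (x + t *\<^sub>R u)) has_real_derivative fu (x + a *\<^sub>R u)) (at a)"
      by (rule shift, rule fu, rule m)
  qed
  obtain a where a: "0 < a" "a < s" and ea:
    "f (x + s *\<^sub>R v + s *\<^sub>R u) - f (x + s *\<^sub>R u) - (f (x + s *\<^sub>R v + 0 *\<^sub>R u) - f (x + 0 *\<^sub>R u)) =
       (s - 0) * (fu (x + s *\<^sub>R v + a *\<^sub>R u) - fu (x + a *\<^sub>R u))"
    using MVT2[OF s d1] by blast
  have d2: "((\<lambda>t. fu (x + a *\<^sub>R u + t *\<^sub>R v)) has_real_derivative fuv (x + a *\<^sub>R u + b *\<^sub>R v)) (at b)"
    if "0 \<le> b" "b \<le> s" for b
    by (rule shift, rule fuv, rule S) (use that a in auto)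
  obtain b where b: "0 < b" "b < s" and eb:
    "fu (x + a *\<^sub>R u + s *\<^sub>R v) - fu (x + a *\<^sub>R u + 0 *\<^sub>R v) = (s - 0) * fuv (x + a *\<^sub>R u + b *\<^sub>R v)"
    using MVT2[OF s d2] by blast
  show thesis
    by (rule that[OF a b]) (use ea eb in \<open>simp add: add_ac\<close>)
qed

text \<open>Schwarz's theorem for directional derivatives: the second difference of \<open>f\<close> is symmetric in \<open>u\<close>
  and \<open>v\<close>, and by the mean value theorem it is \<open>s\<^sup>2\<close> times a nearby value of either mixed derivative.\<close>

lemma mixed_derivatives_commute:
  fixes f :: "'a::real_normed_vector \<Rightarrow> real"
  assumes S: "open S" "x \<in> S"
    and fu: "\<And>y. y \<in> S \<Longrightarrow> ((\<lambda>t. f (y + t *\<^sub>R u)) has_real_derivative fu y) (at 0)"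
    and fv: "\<And>y. y \<in> S \<Longrightarrow> ((\<lambda>t. f (y + t *\<^sub>R v)) has_real_derivative fv y) (at 0)"
    and fuv: "\<And>y. y \<in> S \<Longrightarrow> ((\<lambda>t. fu (y + t *\<^sub>R v)) has_real_derivative fuv y) (at 0)"
    and fvu: "\<And>y. y \<in> S \<Longrightarrow> ((\<lambda>t. fv (y + t *\<^sub>R u)) has_real_derivative fvu y) (at 0)"
    and cont: "continuous_on S fuv" "continuous_on S fvu"
  shows "fuv x = fvu x"
proof -
  have close: "\<bar>fuv x - fvu x\<bar> \<le> e" if e: "e > 0" for e
  proof -
    have "continuous_on S (\<lambda>y. \<bar>fuv y - fuv x\<bar>)" "continuous_on S (\<lambda>y. \<bar>fvu y - fvu x\<bar>)"
      using cont by (intro continuous_intros; simp)+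
    then have "open (S \<inter> (\<lambda>y. \<bar>fuv y - fuv x\<bar>) -` {..<e/2} \<inter> (S \<inter> (\<lambda>y. \<bar>fvu y - fvu x\<bar>) -` {..<e/2}))"
      using S by (intro open_Int continuous_open_preimage) auto
    moreover have "x \<in> S \<inter> (\<lambda>y. \<bar>fuv y - fuv x\<bar>) -` {..<e/2} \<inter> (S \<inter> (\<lambda>y. \<bar>fvu y - fvu x\<bar>) -` {..<e/2})"
      using S e by simp
    ultimately obtain \<delta> where \<delta>: "\<delta> > 0"
      "ball x \<delta> \<subseteq> S \<inter> (\<lambda>y. \<bar>fuv y - fuv x\<bar>) -` {..<e/2} \<inter> (S \<inter> (\<lambda>y. \<bar>fvu y - fvu x\<bar>) -` {..<e/2})"
      by (meson open_contains_ball)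
    \<comment> \<open>Small enough for the parallelogram spanned by \<open>s u\<close> and \<open>s v\<close> at \<open>x\<close> to stay in the ball.\<close>
    define s where "s = \<delta> / (norm u + norm v + 1)"
    have n: "norm u + norm v + 1 > 0" by (simp add: add_nonneg_pos)
    have s: "s > 0" using \<delta> n by (simp add: s_def)
    have near: "x + a *\<^sub>R u + b *\<^sub>R v \<in> ball x \<delta>" if "0 \<le> a" "a \<le> s" "0 \<le> b" "b \<le> s" for a b
    proof -
      have "norm (a *\<^sub>R u + b *\<^sub>R v) \<le> a * norm u + b * norm v"
        using that by (intro order_trans[OF norm_triangle_ineq]) simp
      also have "\<dots> \<le> s * norm u + s * norm v"
        using that by (intro add_mono mult_right_mono) auto
      also have "\<dots> < s * (norm u + norm v + 1)" using s by (simp add: algebra_simps)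
      also have "\<dots> = \<delta>" using n by (simp add: s_def)
      finally show ?thesis unfolding mem_ball add.assoc dist_commute[of x] by (simp add: dist_norm)
    qed
    have inS: "x + a *\<^sub>R u + b *\<^sub>R v \<in> S" "x + b *\<^sub>R v + a *\<^sub>R u \<in> S"
      if "0 \<le> a" "a \<le> s" "0 \<le> b" "b \<le> s" for a b
      using near[OF that] \<delta>(2) by (auto simp: add_ac)
    obtain a b where ab: "0 < a" "a < s" "0 < b" "b < s" and 1:
      "f (x + s *\<^sub>R u + s *\<^sub>R v) - f (x + s *\<^sub>R u) - f (x + s *\<^sub>R v) + f x = s * (s * fuv (x + a *\<^sub>R u + b *\<^sub>R v))"
      by (rule second_difference_mean_value[OF s inS(1) fu fuv]) auto
    obtain b' a' where ab': "0 < b'" "b' < s" "0 < a'" "a' < s" and 2: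
      "f (x + s *\<^sub>R v + s *\<^sub>R u) - f (x + s *\<^sub>R v) - f (x + s *\<^sub>R u) + f x = s * (s * fvu (x + b' *\<^sub>R v + a' *\<^sub>R u))"
      by (rule second_difference_mean_value[OF s inS(2) fv fvu]) auto
    have "s * (s * fuv (x + a *\<^sub>R u + b *\<^sub>R v)) = s * (s * fvu (x + b' *\<^sub>R v + a' *\<^sub>R u))"
      unfolding 1[symmetric] 2[symmetric] by (simp add: add_ac)
    then have eq: "fuv (x + a *\<^sub>R u + b *\<^sub>R v) = fvu (x + b' *\<^sub>R v + a' *\<^sub>R u)" using s by simp
    have "\<bar>fuv (x + a *\<^sub>R u + b *\<^sub>R v) - fuv x\<bar> < e/2"
      using near[of a b] ab \<delta>(2) by auto
    moreover have "\<bar>fvu (x + b' *\<^sub>R v + a' *\<^sub>R u) - fvu x\<bar> < e/2"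
      using near[of a' b'] ab' \<delta>(2) by (auto simp: add_ac)
    ultimately show ?thesis unfolding eq by linarith
  qed
  have "\<bar>fuv x - fvu x\<bar> \<le> 0"
    by (rule field_le_epsilon) (simp only: add_0 close)
  then show ?thesis by simp
qed

lemma smooth_onD:
  assumes "smooth_on S f"
  shows smooth_on_imp_continuous_on: "continuous_on S f"
    and smooth_on_imp_differentiable: "\<And>x. x \<in> S \<Longrightarrow> f differentiable (at x)"
    and smooth_on_ddir: "smooth_on S (ddir v f)"
proof -
  have T: "times_differentiable_on n S f" for n using assms by (simp add: smooth_on_def)
  show "continuous_on S f" using T[of 0] by simp
  show "f differentiable (at x)" if "x \<in> S" for x using T[of "Suc 0"] that by simp
  show "smooth_on S (ddir v f)"
    unfolding smooth_on_def ddir_def[abs_def] using T[of "Suc _"] by simp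
qed

lemma smooth_on_has_derivative:
  assumes "smooth_on S f" "x \<in> S"
  shows "(f has_derivative (\<lambda>u. ddir u f x)) (at x)"
proof -
  have "(f has_derivative frechet_derivative f (at x)) (at x)"
    using smooth_on_imp_differentiable[OF assms] frechet_derivative_works by blast
  then show ?thesis unfolding ddir_def .
qed

lemma ddir_commute:
  fixes f :: "'a::real_normed_vector \<Rightarrow> 'b::real_inner"
  assumes f: "smooth_on S f" and S: "open S" "x \<in> S"
  shows "ddir u (ddir v f) x = ddir v (ddir u f) x"
proof -
  have along: "((\<lambda>t. g (y + t *\<^sub>R w) \<bullet> e) has_real_derivative ddir w g y \<bullet> e) (at 0)"
    if "smooth_on S g" "y \<in> S" for g :: "'a \<Rightarrow> 'b" and y w e
  proof -
    have 1: "((\<lambda>t. y + t *\<^sub>R w) has_derivative (\<lambda>t. t *\<^sub>R w)) (at 0)"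
      by (auto intro!: derivative_eq_intros)
    have "(g has_derivative (\<lambda>u. ddir u g y)) (at (y + 0 *\<^sub>R w))"
      using smooth_on_has_derivative[OF that] by simp
    from has_derivative_compose[OF 1 this]
    have 2: "((\<lambda>t. g (y + t *\<^sub>R w)) has_derivative (\<lambda>t. ddir (t *\<^sub>R w) g y)) (at 0)" .
    have "ddir (t *\<^sub>R w) g y = t *\<^sub>R ddir w g y" for t
      by (rule linear_scale[OF has_derivative_linear[OF smooth_on_has_derivative[OF that]]])
    with has_derivative_inner_left[OF 2, of e] show ?thesis
      by (simp add: has_field_derivative_def mult_commute_abs)
  qed
  have "ddir v (ddir u f) x \<bullet> e = ddir u (ddir v f) x \<bullet> e" for e
    by (rule mixed_derivatives_commute[OF S, of "\<lambda>y. f y \<bullet> e" u "\<lambda>y. ddir u f y \<bullet> e" v "\<lambda>y. ddir v f y \<bullet> e"])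
       (rule along continuous_on_inner smooth_on_imp_continuous_on smooth_on_ddir f continuous_on_const
        | assumption)+
  then have "(ddir v (ddir u f) x - ddir u (ddir v f) x) \<bullet> e = 0" for e
    by (simp add: inner_diff_left)
  from this[of "ddir v (ddir u f) x - ddir u (ddir v f) x"] show ?thesis by simp
qed

section \<open>The transversal field\<close>

lemma vec2_decompose: "(u :: real^2) = (u $ 1) *\<^sub>R axis 1 1 + (u $ 2) *\<^sub>R axis 2 1"
  by (simp add: vec_eq_iff forall_2 axis_def)

text \<open>The linear map \<open>\<Lambda>\<close> whose columns are the vectors of the frame is injective because \<open>z\<close> is transversal,
  hence bijective.\<close>

lemma transversal_frame:
  fixes L :: "real^2 \<Rightarrow> real^3" and z :: "real^3"
  assumes L: "linear L" "inj L" and z: "z \<notin> range L"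
  shows transversal_frame_decomposition: "\<exists>!p. w = L (fst p) + snd p *\<^sub>R z"
    and transversal_frame_det: "det (vector [L (axis 1 1), L (axis 2 1), z] :: real^3^3) \<noteq> 0"
proof -
  define \<Lambda> :: "real^3 \<Rightarrow> real^3" where "\<Lambda> y = L (vector [y $ 1, y $ 2]) + (y $ 3) *\<^sub>R z" for y
  note [simp] = linear_add[OF L(1)] linear_scale[OF L(1)] linear_diff[OF L(1)] linear_0[OF L(1)]
  have v: "(vector [a + b, c + d] :: real^2) = vector [a, c] + vector [b, d]"
    "(vector [k * a, k * c] :: real^2) = k *\<^sub>R vector [a, c]" for a b c d k :: real
    by (simp_all add: vec_eq_iff forall_2)
  have lin: "linear \<Lambda>"
    by (rule linearI) (simp_all add: \<Lambda>_def v algebra_simps)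
  have zero: "u = 0 \<and> c = 0" if "L u + c *\<^sub>R z = 0" for u c
  proof -
    have "c = 0"
    proof (rule ccontr)
      assume "c \<noteq> 0"
      have "L (- (1 / c) *\<^sub>R u) = - (1 / c) *\<^sub>R L u" by (rule linear_scale[OF L(1)])
      also have "L u = - (c *\<^sub>R z)" using that by (simp add: eq_neg_iff_add_eq_0)
      finally have "z = L (- (1 / c) *\<^sub>R u)" using \<open>c \<noteq> 0\<close> by simp
      then show False using z by blast
    qed
    moreover have "u = 0" using that \<open>c = 0\<close> L(2) linear_injective_0[OF L(1)] by simp
    ultimately show ?thesis by simp
  qed
  have inj: "inj \<Lambda>"
    unfolding linear_injective_0[OF lin]
  proof (intro allI impI)
    fix y assume "\<Lambda> y = 0"
    from zero[OF this[unfolded \<Lambda>_def]] have "(vector [y $ 1, y $ 2] :: real^2) = 0" "y $ 3 = 0" by auto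
    then show "y = 0" by (simp add: vec_eq_iff forall_2 forall_3)
  qed
  have "surj \<Lambda>" using lin inj by (rule linear_inj_imp_surj)
  then obtain y where y: "w = \<Lambda> y" by blast
  show "\<exists>!p. w = L (fst p) + snd p *\<^sub>R z"
  proof (rule ex1I[of _ "(vector [y $ 1, y $ 2], y $ 3)"])
    show "w = L (fst (vector [y $ 1, y $ 2], y $ 3)) + snd (vector [y $ 1, y $ 2] :: real^2, y $ 3) *\<^sub>R z"
      using y by (simp add: \<Lambda>_def)
    fix p assume "w = L (fst p) + snd p *\<^sub>R z"
    then have "L (fst p - vector [y $ 1, y $ 2]) + (snd p - y $ 3) *\<^sub>R z = 0"
      using y by (simp add: \<Lambda>_def algebra_simps)
    from zero[OF this] show "p = (vector [y $ 1, y $ 2], y $ 3)" by (simp add: prod_eq_iff)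
  qed
  have "matrix \<Lambda> = transpose (vector [L (axis 1 1), L (axis 2 1), z])"
  proof -
    have ax: "(vector [1, 0] :: real^2) = axis 1 1" "(vector [0, 1] :: real^2) = axis 2 1"
      "(vector [0, 0] :: real^2) = 0"
      by (simp_all add: vec_eq_iff forall_2 axis_def)
    show ?thesis
      by (simp add: matrix_def transpose_def vec_eq_iff forall_3 \<Lambda>_def axis_def ax[unfolded axis_def])
  qed
  then show "det (vector [L (axis 1 1), L (axis 2 1), z] :: real^3^3) \<noteq> 0"
    using det_nz_iff_inj[OF lin] inj by (simp add: det_transpose)
qed

lemma det_frame_component:
  fixes L :: "real^2 \<Rightarrow> real^3" and z :: "real^3"
  assumes L: "linear L"
  shows "det (vector [L (axis 1 1), L (axis 2 1), L u + c *\<^sub>R z] :: real^3^3) =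
    c * det (vector [L (axis 1 1), L (axis 2 1), z] :: real^3^3)"
proof -
  have "L u = (u $ 1) *\<^sub>R L (axis 1 1) + (u $ 2) *\<^sub>R L (axis 2 1)"
    by (subst vec2_decompose[of u]) (simp only: linear_add[OF L] linear_scale[OF L])
  then show ?thesis by (simp add: det_3 algebra_simps)
qed

text \<open>For a transversal field the decomposition behind the Gauss formula exists and is unique.  Its
  transversal component is a quotient of determinants, by Cramer's rule; this yields the continuity and
  the symmetry of the second fundamental form.\<close>

lemma decomp_transversal:
  assumes F: "(F has_derivative (\<lambda>u. ddir u F x)) (at x)"
    and inj: "inj (frechet_derivative F (at x))"
    and z: "Z x \<notin> range (frechet_derivative F (at x))"
  shows decomp_eq: "w = ddir (fst (decomp F Z x w)) F x + snd (decomp F Z x w) *\<^sub>R Z x"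
    and decomp_unique: "w = ddir u F x + c *\<^sub>R Z x \<Longrightarrow> decomp F Z x w = (u, c)"
    and vol_form_nonzero: "vol_form F Z x (axis 1 1) (axis 2 1) \<noteq> 0"
    and snd_decomp: "snd (decomp F Z x w) =
      det (vector [ddir (axis 1 1) F x, ddir (axis 2 1) F x, w] :: real^3^3) / vol_form F Z x (axis 1 1) (axis 2 1)"
proof -
  have eta: "frechet_derivative F (at x) = (\<lambda>u. ddir u F x)" by (simp add: ddir_def)
  have lin: "linear (\<lambda>u. ddir u F x)" by (rule has_derivative_linear[OF F])
  note frame = transversal_frame[OF lin inj[unfolded eta] z[unfolded eta]]
  show eq: "w = ddir (fst (decomp F Z x w)) F x + snd (decomp F Z x w) *\<^sub>R Z x" for w
    using theI'[OF frame(1)[of w]] unfolding decomp_def .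
  show "decomp F Z x w = (u, c)" if "w = ddir u F x + c *\<^sub>R Z x"
    unfolding decomp_def by (rule the1_equality[OF frame(1)]) (simp add: that)
  show nz: "vol_form F Z x (axis 1 1) (axis 2 1) \<noteq> 0"
    using frame(2) by (simp add: vol_form_def)
  show "snd (decomp F Z x w) =
      det (vector [ddir (axis 1 1) F x, ddir (axis 2 1) F x, w] :: real^3^3) / vol_form F Z x (axis 1 1) (axis 2 1)"
    using det_frame_component[OF lin, of "fst (decomp F Z x w)" "snd (decomp F Z x w)" "Z x"] eq[of w] nz
    by (simp add: vol_form_def)
qed

lemma has_derivative_det3:
  fixes a b c :: "'a::real_normed_vector \<Rightarrow> real^3"
  assumes "(a has_derivative a') (at x)" "(b has_derivative b') (at x)" "(c has_derivative c') (at x)"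
  shows "((\<lambda>y. det (vector [a y, b y, c y] :: real^3^3)) has_derivative
    (\<lambda>u. det (vector [a' u, b x, c x] :: real^3^3) + det (vector [a x, b' u, c x] :: real^3^3)
       + det (vector [a x, b x, c' u] :: real^3^3))) (at x)"
proof -
  have comp: "((\<lambda>y. f y $ i) has_derivative (\<lambda>u. f' u $ i)) (at x)"
    if "(f has_derivative f') (at x)" for f f' :: "'a \<Rightarrow> real^3" and i
    using that by (rule bounded_linear.has_derivative[OF bounded_linear_vec_nth])
  show ?thesis
    unfolding det_3 vector_3
    by (rule has_derivative_eq_rhs,
        (rule has_derivative_add has_derivative_diff has_derivative_mult comp assms)+)
       (simp add: algebra_simps)
qed

text \<open>Differentiating \<open>\<nu> = det (F\<^sub>1, F\<^sub>2, Z)\<close> and inserting the Gauss and Weingarten formulas gives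
  \<open>\<nabla>\<^sub>u \<nu> = \<tau>(u) \<nu>\<close>.  So an equiaffine field has \<open>\<tau> = 0\<close>, and if the shape operator vanishes
  too, then nothing is left of the derivative of \<open>Z\<close>.\<close>

lemma ddir_transversal_eq_0:
  assumes x: "x \<in> S" and F: "smooth_on S F" and Z: "smooth_on S Z"
    and inj: "inj (frechet_derivative F (at x))"
    and z: "Z x \<notin> range (frechet_derivative F (at x))"
    and equi: "\<And>v w. nabla_vol F Z x u v w = 0"
    and shape: "shape_op F Z x u = 0"
  shows "ddir u Z x = 0"
proof -
  let ?e1 = "axis 1 1 :: real^2" and ?e2 = "axis 2 1 :: real^2"
  note dF = smooth_on_has_derivative[OF F x]
  note dec = decomp_transversal[where F = F and Z = Z and x = x, OF dF inj z]
  define \<tau> where "\<tau> = snd (decomp F Z x (ddir u Z x))"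
  have lin: "linear (\<lambda>u. ddir u F x)" by (rule has_derivative_linear[OF dF])
  have \<tau>: "ddir u Z x = \<tau> *\<^sub>R Z x"
    using dec(1)[of "ddir u Z x"] shape linear_0[OF lin] by (simp add: \<tau>_def shape_op_def)
  have Fuv: "ddir u (ddir v F) x = ddir (conn F Z x u v) F x + sff F Z x u v *\<^sub>R Z x" for v
    unfolding conn_def sff_def by (rule dec(1))
  have "((\<lambda>y. vol_form F Z y ?e1 ?e2) has_derivative
      (\<lambda>u. det (vector [ddir u (ddir ?e1 F) x, ddir ?e2 F x, Z x] :: real^3^3)
        + det (vector [ddir ?e1 F x, ddir u (ddir ?e2 F) x, Z x] :: real^3^3)
        + det (vector [ddir ?e1 F x, ddir ?e2 F x, ddir u Z x] :: real^3^3))) (at x)"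
    unfolding vol_form_def
    by (intro has_derivative_det3 smooth_on_has_derivative[OF _ x] smooth_on_ddir F Z)
  from frechet_derivative_at[OF this]
  have "ddir u (\<lambda>y. vol_form F Z y ?e1 ?e2) x =
      det (vector [ddir u (ddir ?e1 F) x, ddir ?e2 F x, Z x] :: real^3^3)
        + det (vector [ddir ?e1 F x, ddir u (ddir ?e2 F) x, Z x] :: real^3^3)
        + det (vector [ddir ?e1 F x, ddir ?e2 F x, ddir u Z x] :: real^3^3)"
    unfolding ddir_def[of u "\<lambda>y. vol_form F Z y ?e1 ?e2"] by (simp add: fun_eq_iff)
  also have "\<dots> = vol_form F Z x (conn F Z x u ?e1) ?e2 + vol_form F Z x ?e1 (conn F Z x u ?e2)
       + \<tau> * vol_form F Z x ?e1 ?e2"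
    unfolding Fuv \<tau> vol_form_def by (simp add: det_3 algebra_simps)
  finally have "\<tau> * vol_form F Z x ?e1 ?e2 = 0"
    using equi[of ?e1 ?e2] unfolding nabla_vol_def by simp
  then have "\<tau> = 0" using dec(3) by simp
  then show ?thesis using \<tau> by simp
qed

section \<open>The surface as a graph over the Monge-Ampere domain\<close>

text \<open>The affine change of coordinates that makes the constant affine normal \<open>z\<close> vertical: a rotation
  that takes \<open>z\<close> to the third axis, followed by the scaling of that axis by \<open>s = \<sigma> / \<bar>z\<bar>\<^sup>2\<close>.  This
  is the scaling for which the determinant \<open>s\<close> of the map and the height \<open>\<kappa> = s \<bar>z\<bar>\<close> of the image of \<open>z\<close>
  satisfy \<open>s\<^sup>2 = \<kappa>\<^sup>4\<close>.  Then the normalisation \<open>\<nu>\<^sub>\<xi> = \<nu>\<^sub>g\<close> will give the Hessian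
  determinant exactly 1.  The sign \<open>\<sigma>\<close> serves to turn a concave graph into a convex one.\<close>

lemma normalizing_matrix:
  fixes z :: "real^3"
  assumes z: "z \<noteq> 0" and \<sigma>: "\<sigma> = 1 \<or> \<sigma> = (-1::real)"
  obtains M :: "real^3^3" and \<kappa> where "invertible M" "M *v z = \<kappa> *\<^sub>R axis 3 1" "\<sigma> * \<kappa> > 0"
    "\<And>a b. (\<kappa> * det (vector [a, b, z] :: real^3^3))\<^sup>2 =
       ((M *v a) $ 1 * (M *v b) $ 2 - (M *v a) $ 2 * (M *v b) $ 1)\<^sup>2"
proof -
  define \<rho> where "\<rho> = norm z"
  have \<rho>: "\<rho> > 0" using z by (simp add: \<rho>_def)
  have "norm z = norm (\<rho> *\<^sub>R axis 3 1 :: real^3)" by (simp add: \<rho>_def norm_axis_1)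
  then obtain f where f: "orthogonal_transformation f" "det (matrix f) = 1" "f z = \<rho> *\<^sub>R axis 3 1"
    by (rule rotation_exists[rotated]) auto
  have fv: "matrix f *v a = f a" for a
    using f(1) by (simp add: matrix_works orthogonal_transformation_linear)
  define s where "s = \<sigma> / \<rho>\<^sup>2"
  define R :: "real^3^3" where "R = vector [axis 1 1, axis 2 1, s *\<^sub>R axis 3 1]"
  define M where "M = R ** matrix f"
  have Rv: "R *v a = vector [a $ 1, a $ 2, s * a $ 3]" for a
    by (simp add: R_def matrix_vector_mult_def vec_eq_iff forall_3 sum_3 axis_def)
  have detR: "det R = s" by (simp add: R_def det_3 axis_def)
  have Mv: "M *v a = vector [f a $ 1, f a $ 2, s * f a $ 3]" for a
    unfolding M_def by (simp add: matrix_vector_mul_assoc[symmetric] fv Rv)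
  have detM: "det M = s" by (simp add: M_def det_mul f(2) detR)
  define \<kappa> where "\<kappa> = s * \<rho>"
  have Mz: "M *v z = \<kappa> *\<^sub>R axis 3 1"
    by (simp add: Mv f(3) vec_eq_iff forall_3 axis_def \<kappa>_def)
  have s2: "s\<^sup>2 = \<kappa>\<^sup>2 * \<kappa>\<^sup>2"
    using \<sigma> \<rho> by (auto simp: s_def \<kappa>_def power2_eq_square field_simps)
  have \<kappa>0: "\<kappa> \<noteq> 0" using \<sigma> \<rho> by (auto simp: s_def \<kappa>_def)
  show thesis
  proof (rule that[of M \<kappa>])
    show "invertible M" using \<kappa>0 by (simp add: invertible_det_nz detM \<kappa>_def)
    show "M *v z = \<kappa> *\<^sub>R axis 3 1" by (rule Mz)
    show "\<sigma> * \<kappa> > 0" using \<sigma> \<rho> by (auto simp: s_def \<kappa>_def)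
    fix a b
    let ?d = "(M *v a) $ 1 * (M *v b) $ 2 - (M *v a) $ 2 * (M *v b) $ 1"
    have "vector [M *v a, M *v b, M *v z] = (vector [a, b, z] :: real^3^3) ** transpose M"
      by (simp add: vec_eq_iff forall_3 matrix_matrix_mult_def matrix_vector_mult_def transpose_def sum_3 mult.commute)
    then have "det (vector [M *v a, M *v b, M *v z] :: real^3^3) = det (vector [a, b, z] :: real^3^3) * s"
      by (simp add: det_mul detM)
    moreover have "det (vector [M *v a, M *v b, M *v z] :: real^3^3) = \<kappa> * ?d"
      unfolding Mz by (simp add: det_3 axis_def algebra_simps)
    ultimately have "(\<kappa> * ?d)\<^sup>2 = (det (vector [a, b, z] :: real^3^3) * s)\<^sup>2" by simp
    then have "\<kappa>\<^sup>2 * ?d\<^sup>2 = \<kappa>\<^sup>2 * (\<kappa> * det (vector [a, b, z] :: real^3^3))\<^sup>2"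
      unfolding power_mult_distrib s2 by (simp add: algebra_simps)
    then show "(\<kappa> * det (vector [a, b, z] :: real^3^3))\<^sup>2 = ?d\<^sup>2" using \<kappa>0 by simp
  qed
qed

lemma bilinear2_det:
  fixes b :: "real^2 \<Rightarrow> real^2 \<Rightarrow> real"
  assumes b: "\<And>v. linear (\<lambda>u. b u v)" "\<And>u. linear (b u)"
  shows bilinear2_expand: "b u v = u $ 1 * v $ 1 * b (axis 1 1) (axis 1 1) + u $ 1 * v $ 2 * b (axis 1 1) (axis 2 1)
      + u $ 2 * v $ 1 * b (axis 2 1) (axis 1 1) + u $ 2 * v $ 2 * b (axis 2 1) (axis 2 1)"
    and "b s s * b t t - b s t * b t s = det (gram b) * (s $ 1 * t $ 2 - s $ 2 * t $ 1)\<^sup>2"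
proof -
  show expand: "b u v = u $ 1 * v $ 1 * b (axis 1 1) (axis 1 1) + u $ 1 * v $ 2 * b (axis 1 1) (axis 2 1)
      + u $ 2 * v $ 1 * b (axis 2 1) (axis 1 1) + u $ 2 * v $ 2 * b (axis 2 1) (axis 2 1)" for u v
  proof -
    have 1: "b u w = u $ 1 * b (axis 1 1) w + u $ 2 * b (axis 2 1) w" for w
      by (subst vec2_decompose[of u]) (simp only: linear_add[OF b(1)] linear_scale[OF b(1)] real_scaleR_def)
    have 2: "b w v = v $ 1 * b w (axis 1 1) + v $ 2 * b w (axis 2 1)" for w
      by (subst vec2_decompose[of v]) (simp only: linear_add[OF b(2)] linear_scale[OF b(2)] real_scaleR_def)
    show ?thesis unfolding 1[of v] 2[of "axis 1 1"] 2[of "axis 2 1"] by (simp add: algebra_simps)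
  qed
  show "b s s * b t t - b s t * b t s = det (gram b) * (s $ 1 * t $ 2 - s $ 2 * t $ 1)\<^sup>2"
    unfolding expand[of s s] expand[of s t] expand[of t s] expand[of t t]
    by (simp add: det_2 gram_def power2_eq_square algebra_simps)
qed

lemma definite_det_gram_pos:
  fixes b :: "real^2 \<Rightarrow> real^2 \<Rightarrow> real"
  assumes b: "\<And>v. linear (\<lambda>u. b u v)" "\<And>u. linear (b u)"
    and sym: "\<And>u v. b u v = b v u" and pos: "\<And>u. u \<noteq> 0 \<Longrightarrow> b u u > 0"
  shows "det (gram b) > 0"
proof -
  define g11 g12 g22 where "g11 = b (axis 1 1) (axis 1 1)" and "g12 = b (axis 1 1) (axis 2 1)"
    and "g22 = b (axis 2 1) (axis 2 1)"
  have g11: "g11 > 0" unfolding g11_def by (rule pos) (simp add: axis_eq_0_iff)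
  \<comment> \<open>At this vector the form takes the value \<open>g11\<close> times the Gram determinant.\<close>
  define u :: "real^2" where "u = vector [- g12, g11]"
  have "u \<noteq> 0" using g11 by (auto simp: u_def vec_eq_iff forall_2)
  then have "0 < b u u" by (rule pos)
  also have "b u u = g11 * (g11 * g22 - g12 * g12)"
    unfolding bilinear2_expand[OF b, of u u] unfolding u_def sym[of "axis 2 1" "axis 1 1"]
      g11_def[symmetric] g12_def[symmetric] g22_def[symmetric]
    by (simp add: algebra_simps)
  finally have "g11 * g22 - g12 * g12 > 0" using g11 by (simp add: zero_less_mult_iff)
  then show ?thesis
    using sym[of "axis 2 1" "axis 1 1"] by (simp add: det_2 gram_def g11_def g12_def g22_def)
qed

text \<open>Solves for the gradient \<open>p\<close> of the height over the graph coordinates: \<open>a1\<close>, \<open>a2\<close> are the horizontal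
  parts of the coordinate vectors and \<open>h1\<close>, \<open>h2\<close> their heights.  The explicit formula shows that \<open>p\<close>
  is differentiable.\<close>

lemma gradient_by_Cramer:
  fixes a1 a2 :: "real^2" and h1 h2 :: real
  assumes J: "a1 $ 1 * a2 $ 2 - a1 $ 2 * a2 $ 1 \<noteq> 0"
  defines "p \<equiv> ((h1 * a2 $ 2 - h2 * a1 $ 2) / (a1 $ 1 * a2 $ 2 - a1 $ 2 * a2 $ 1)) *\<^sub>R axis 1 1 +
    ((a1 $ 1 * h2 - a2 $ 1 * h1) / (a1 $ 1 * a2 $ 2 - a1 $ 2 * a2 $ 1)) *\<^sub>R (axis 2 1 :: real^2)"
  shows "p \<bullet> a1 = h1" "p \<bullet> a2 = h2"
proof -
  have "p \<bullet> a = ((h1 * a2 $ 2 - h2 * a1 $ 2) * a $ 1 + (a1 $ 1 * h2 - a2 $ 1 * h1) * a $ 2) /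
      (a1 $ 1 * a2 $ 2 - a1 $ 2 * a2 $ 1)" for a
    by (simp add: p_def inner_add_left inner_axis' add_divide_distrib)
  moreover have "(h1 * a2 $ 2 - h2 * a1 $ 2) * a1 $ 1 + (a1 $ 1 * h2 - a2 $ 1 * h1) * a1 $ 2
      = h1 * (a1 $ 1 * a2 $ 2 - a1 $ 2 * a2 $ 1)"
    and "(h1 * a2 $ 2 - h2 * a1 $ 2) * a2 $ 1 + (a1 $ 1 * h2 - a2 $ 1 * h1) * a2 $ 2
      = h2 * (a1 $ 1 * a2 $ 2 - a1 $ 2 * a2 $ 1)"
    by (simp_all add: algebra_simps)
  ultimately show "p \<bullet> a1 = h1" "p \<bullet> a2 = h2" using J by simp_all
qed

text \<open>After the affine normalisation, the horizontal part \<open>X\<close> of the surface is a local coordinate and the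
  height is a function \<open>\<Psi>\<close> of it.  With the gradient \<open>p\<close> of \<open>\<Psi>\<close> at \<open>X x\<close>, differentiation of
  \<open>p \<bullet> X\<^sub>v = ht F\<^sub>v\<close> and the Gauss formula give \<open>p\<^sub>u \<bullet> X\<^sub>v = \<kappa> g(u, v)\<close>: in the coordinate
  \<open>X\<close>, the Hessian of \<open>\<Psi>\<close> is \<open>\<kappa>\<close> times the Blaschke metric.  So it is positive definite, and its
  determinant is \<open>\<kappa>\<^sup>2 det g / J\<^sup>2 = \<kappa>\<^sup>2 \<nu>\<^sup>2 / J\<^sup>2 = 1\<close>, where \<open>J\<close> is the Jacobian of \<open>X\<close>.\<close>

lemma improper_affine_sphere_local_graph:
  fixes F Z :: "real^2 \<Rightarrow> real^3"
  assumes U: "open U" "x0 \<in> U" and F: "smooth_on U F" and Z: "smooth_on U Z"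
    and inj: "\<And>x. x \<in> U \<Longrightarrow> inj (frechet_derivative F (at x))"
    and trans: "\<And>x. x \<in> U \<Longrightarrow> Z x \<notin> range (frechet_derivative F (at x))"
    and equi: "\<And>x u v w. x \<in> U \<Longrightarrow> nabla_vol F Z x u v w = 0"
    and shape: "\<And>x u. x \<in> U \<Longrightarrow> shape_op F Z x u = 0"
    and vol: "\<And>x. x \<in> U \<Longrightarrow> vol_form F Z x (axis 1 1) (axis 2 1) = sqrt \<bar>det (gram (sff F Z x))\<bar>"
    and conv: "\<And>x. x \<in> U \<Longrightarrow> (\<forall>u. u \<noteq> 0 \<longrightarrow> sff F Z x u u > 0) \<or> (\<forall>u. u \<noteq> 0 \<longrightarrow> sff F Z x u u < 0)"
  obtains U' and M :: "real^3^3" and W :: "(real^2) set" and \<Psi> :: "real^2 \<Rightarrow> real"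
  where "open U'" "x0 \<in> U'" "U' \<subseteq> U" "invertible M" "open W" "real_analytic_on W \<Psi>"
    "(\<lambda>x. M *v F x) ` U' = (\<lambda>y. vector [y $ 1, y $ 2, \<Psi> y]) ` W"
proof -
  let ?e1 = "axis 1 1 :: real^2" and ?e2 = "axis 2 1 :: real^2"
  define g where "g = sff F Z"
  note dF = smooth_on_has_derivative[OF F]
  note dZ = smooth_on_has_derivative[OF Z]
  note ddF = smooth_on_has_derivative[OF smooth_on_ddir[OF F]]
  have dec: "w = ddir (fst (decomp F Z x w)) F x + snd (decomp F Z x w) *\<^sub>R Z x"
    "w = ddir u F x + c *\<^sub>R Z x \<Longrightarrow> decomp F Z x w = (u, c)"
    "vol_form F Z x ?e1 ?e2 \<noteq> 0"
    "snd (decomp F Z x w) = det (vector [ddir ?e1 F x, ddir ?e2 F x, w] :: real^3^3) / vol_form F Z x ?e1 ?e2"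
    if "x \<in> U" for x w u c
    using decomp_transversal[where F = F and Z = Z and x = x, OF dF[OF that] inj[OF that] trans[OF that]] by blast+
  have linF: "linear (\<lambda>u. ddir u F x)" if "x \<in> U" for x
    by (rule has_derivative_linear[OF dF[OF that]])
  have Z': "ddir u Z x = 0" if "x \<in> U" for x u
    by (rule ddir_transversal_eq_0[OF that F Z inj[OF that] trans[OF that] equi[OF that] shape[OF that]])
  obtain \<delta> where \<delta>: "\<delta> > 0" "ball x0 \<delta> \<subseteq> U"
    using U open_contains_ball by blast
  define Z0 where "Z0 = Z x0"
  have Zconst: "Z x = Z0" if "x \<in> ball x0 \<delta>" for x
    unfolding Z0_def
  proof (rule has_derivative_zero_unique[OF convex_ball _ that])
    show "(Z has_derivative (\<lambda>h. 0)) (at y within ball x0 \<delta>)" if "y \<in> ball x0 \<delta>" for y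
    proof -
      have "y \<in> U" using that \<delta>(2) by blast
      from has_derivative_at_withinI[OF dZ[OF this]] show ?thesis unfolding Z'[OF \<open>y \<in> U\<close>] .
    qed
  qed (use \<delta>(1) in simp)
  have Z0: "Z0 \<noteq> 0"
  proof
    assume "Z0 = 0"
    then have "Z x0 = frechet_derivative F (at x0) 0"
      using linear_0[OF linF[OF U(2)]] by (simp add: Z0_def ddir_def)
    then show False using trans[OF U(2)] by blast
  qed
  have g_det: "g x u v = det (vector [ddir ?e1 F x, ddir ?e2 F x, ddir u (ddir v F) x] :: real^3^3)
      / vol_form F Z x ?e1 ?e2" if "x \<in> U" for x u v
    unfolding g_def sff_def by (rule dec(4)[OF that])
  have g_sym: "g x u v = g x v u" if "x \<in> U" for x u v
    unfolding g_det[OF that] ddir_commute[OF F U(1) that, of u v] ..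
  have g_cont: "continuous_on U (\<lambda>x. g x ?e1 ?e1)"
  proof -
    have "continuous_on U (\<lambda>x. det (vector [ddir ?e1 F x, ddir ?e2 F x, ddir ?e1 (ddir ?e1 F) x] :: real^3^3)
        / vol_form F Z x ?e1 ?e2)"
      unfolding vol_form_def det_3 vector_3
      by (intro continuous_intros smooth_on_imp_continuous_on smooth_on_ddir F Z)
         (use dec(3) in \<open>simp add: vol_form_def det_3\<close>)
    then show ?thesis by (rule continuous_on_eq) (simp add: g_det)
  qed
  have g_def': "(\<forall>u. u \<noteq> 0 \<longrightarrow> g x u u > 0) \<or> (\<forall>u. u \<noteq> 0 \<longrightarrow> g x u u < 0)" if "x \<in> U" for x
    using conv[OF that] by (simp add: g_def)
  have e1: "?e1 \<noteq> 0" by (simp add: axis_eq_0_iff)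
  \<comment> \<open>The metric is definite with a sign that is constant near \<open>x0\<close>, by continuity.\<close>
  define \<sigma> :: real where "\<sigma> = (if g x0 ?e1 ?e1 > 0 then 1 else -1)"
  have \<sigma>: "\<sigma> = 1 \<or> \<sigma> = -1" by (simp add: \<sigma>_def)
  define U1 where "U1 = ball x0 \<delta> \<inter> (\<lambda>x. \<sigma> * g x ?e1 ?e1) -` {0<..}"
  have U1: "open U1" "U1 \<subseteq> ball x0 \<delta>" "U1 \<subseteq> U"
  proof -
    have "continuous_on (ball x0 \<delta>) (\<lambda>x. \<sigma> * g x ?e1 ?e1)"
      using \<delta>(2) by (intro continuous_intros continuous_on_subset[OF g_cont])
    then show "open U1" unfolding U1_def by (intro continuous_open_preimage) auto
    show "U1 \<subseteq> ball x0 \<delta>" "U1 \<subseteq> U" using \<delta>(2) by (auto simp: U1_def)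
  qed
  have x0U1: "x0 \<in> U1"
    using g_def'[OF U(2)] e1 \<delta>(1) by (auto simp: U1_def \<sigma>_def)
  have \<sigma>g: "\<sigma> * g x u u > 0" if "x \<in> U1" "u \<noteq> 0" for x u
  proof -
    have "\<sigma> * g x ?e1 ?e1 > 0" "x \<in> U" using that U1 by (auto simp: U1_def)
    then show ?thesis using g_def'[of x] \<sigma> e1 that(2) by fastforce
  qed
  obtain M :: "real^3^3" and \<kappa> where M: "invertible M" "M *v Z0 = \<kappa> *\<^sub>R axis 3 1" "\<sigma> * \<kappa> > 0"
    and M2: "\<And>a b. (\<kappa> * det (vector [a, b, Z0] :: real^3^3))\<^sup>2 =
       ((M *v a) $ 1 * (M *v b) $ 2 - (M *v a) $ 2 * (M *v b) $ 1)\<^sup>2"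
    by (rule normalizing_matrix[OF Z0 \<sigma>]) blast
  have \<kappa>0: "\<kappa> \<noteq> 0" using M(3) by auto
  have \<kappa>g: "\<kappa> * g x u u > 0" if "x \<in> U1" "u \<noteq> 0" for x u
  proof -
    have "0 < (\<sigma> * \<kappa>) * (\<sigma> * g x u u)" by (rule mult_pos_pos[OF M(3) \<sigma>g[OF that]])
    also have "\<dots> = \<kappa> * g x u u" using \<sigma> by auto
    finally show ?thesis .
  qed
  define pr :: "real^3 \<Rightarrow> real^2" where "pr w = vector [(M *v w) $ 1, (M *v w) $ 2]" for w
  define ht :: "real^3 \<Rightarrow> real" where "ht w = (M *v w) $ 3" for w
  have pr: "bounded_linear pr" and ht: "bounded_linear ht"
    unfolding linear_conv_bounded_linear[symmetric]
    by (auto intro!: linearI simp: pr_def ht_def vec_eq_iff forall_2 matrix_vector_right_distrib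
        matrix_vector_mult_scaleR)
  note pr_lin = bounded_linear.linear[OF pr] and ht_lin = bounded_linear.linear[OF ht]
  have prZ: "pr Z0 = 0" "ht Z0 = \<kappa>" by (simp_all add: pr_def ht_def M(2) vec_eq_iff forall_2 axis_def)
  define X where "X x = pr (F x)" for x
  define X' where "X' x u = pr (ddir u F x)" for x u
  have dX: "(X has_derivative X' x) (at x)" if "x \<in> U" for x
    unfolding X_def X'_def by (rule bounded_linear.has_derivative[OF pr dF[OF that]])
  have X'lin: "linear (X' x)" if "x \<in> U" for x by (rule has_derivative_linear[OF dX[OF that]])
  \<comment> \<open>A tangent vector with vanishing horizontal part is a multiple of the normal, against transversality.\<close>
  have X'0: "u = 0" if x: "x \<in> U1" and "X' x u = 0" for x u
  proof -
    have xU: "x \<in> U" using x U1 by blast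
    define c where "c = ht (ddir u F x) / \<kappa>"
    have "M *v ddir u F x = M *v (c *\<^sub>R Z0)"
      using that(2) \<kappa>0 unfolding matrix_vector_mult_scaleR M(2)
      by (simp add: X'_def pr_def ht_def c_def vec_eq_iff forall_2 forall_3 axis_def)
    then have "ddir u F x = c *\<^sub>R Z0"
      using M(1) by (metis invertible_def matrix_vector_mul_assoc matrix_vector_mul_lid)
    then have "ddir u F x = ddir 0 F x + c *\<^sub>R Z x"
      using Zconst[of x] x U1(2) linear_0[OF linF[OF xU]] by auto
    then have "decomp F Z x (ddir u F x) = (0, c)" by (rule dec(2)[OF xU])
    moreover have "decomp F Z x (ddir u F x) = (u, 0)" by (rule dec(2)[OF xU]) simp
    ultimately show "u = 0" by simp
  qed
  obtain U' V G G' where U': "open U'" "U' \<subseteq> U1" "x0 \<in> U'" and V: "open V"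
    and hom: "homeomorphism U' V X G"
    and dG: "\<And>y. y \<in> V \<Longrightarrow> (G has_derivative G' y) (at y)"
    and G': "\<And>y w. y \<in> V \<Longrightarrow> X' (G y) (G' y w) = w"
  proof -
    define f' where "f' x = Blinfun (X' x)" for x
    have f': "blinfun_apply (f' x) = X' x" if "x \<in> U" for x
      unfolding f'_def by (rule bounded_linear_Blinfun_apply[OF has_derivative_bounded_linear[OF dX[OF that]]])
    have cont: "continuous_on U1 f'"
    proof (rule continuous_on_blinfun_componentwise)
      fix i :: "real^2"
      have "continuous_on U1 (\<lambda>x. X' x i)"
        unfolding X'_def using U1(3)
        by (intro bounded_linear.continuous_on[OF pr] continuous_on_subset[OF smooth_on_imp_continuous_on[OF smooth_on_ddir[OF F]]])
      then show "continuous_on U1 (\<lambda>x. blinfun_apply (f' x) i)"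
        by (rule continuous_on_eq) (use f' U1(3) in auto)
    qed
    have "inj (X' x0)"
      unfolding linear_injective_0[OF X'lin[OF U(2)]] using X'0[OF x0U1] by blast
    then obtain L where L: "linear L" "\<And>u. L (X' x0 u) = u"
      using linear_injective_isomorphism[OF X'lin[OF U(2)]] by blast
    have inv: "Blinfun L o\<^sub>L f' x0 = id_blinfun"
      using L by (intro blinfun_eqI)
        (simp add: f'[OF U(2)] bounded_linear_Blinfun_apply linear_conv_bounded_linear)
    have dX1: "(X has_derivative blinfun_apply (f' x)) (at x)" if "x \<in> U1" for x
      using dX[of x] f'[of x] U1(3) that by auto
    show thesis
    proof (rule inverse_function_theorem[OF U1(1) dX1 cont x0U1 inv])
      fix U' V G G'
      assume *: "open U'" "U' \<subseteq> U1" "x0 \<in> U'" "open V" "homeomorphism U' V X G"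
        "\<And>y. y \<in> V \<Longrightarrow> (G has_derivative G' y) (at y)"
        "\<And>y. y \<in> V \<Longrightarrow> G' y = inv (blinfun_apply (f' (G y)))"
        "\<And>y. y \<in> V \<Longrightarrow> bij (blinfun_apply (f' (G y)))"
      have "X' (G y) (G' y w) = w" if y: "y \<in> V" for y w
      proof -
        have "G y \<in> U" using *(2,5) U1(3) y unfolding homeomorphism_def by blast
        then have "bij (X' (G y))" "G' y = inv (X' (G y))" using *(7,8)[OF y] f' by auto
        then show ?thesis by (simp add: bij_is_surj surj_f_inv_f)
      qed
      with * show thesis by (intro that)
    qed
  qed
  have GU: "G y \<in> U'" "G y \<in> U1" "G y \<in> U" if "y \<in> V" for y
    using hom that U' U1 unfolding homeomorphism_def by blast+
  define J where "J x = X' x ?e1 $ 1 * X' x ?e2 $ 2 - X' x ?e1 $ 2 * X' x ?e2 $ 1" for x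
  have J: "(J x)\<^sup>2 = \<kappa>\<^sup>2 * (vol_form F Z x ?e1 ?e2)\<^sup>2" if "x \<in> U1" for x
    using M2[of "ddir ?e1 F x" "ddir ?e2 F x"] Zconst[of x] that U1(2)
    by (auto simp: J_def X'_def pr_def vol_form_def power_mult_distrib)
  have J0: "J x \<noteq> 0" if "x \<in> U1" for x
    using J[OF that] dec(3)[of x] \<kappa>0 that U1(3) by auto
  define p where "p x = ((ht (ddir ?e1 F x) * X' x ?e2 $ 2 - ht (ddir ?e2 F x) * X' x ?e1 $ 2) / J x) *\<^sub>R ?e1
    + ((X' x ?e1 $ 1 * ht (ddir ?e2 F x) - X' x ?e2 $ 1 * ht (ddir ?e1 F x)) / J x) *\<^sub>R ?e2" for x
  have p: "p x \<bullet> X' x u = ht (ddir u F x)" if x: "x \<in> U1" for x u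
  proof -
    have xU: "x \<in> U" using x U1 by blast
    have b: "p x \<bullet> X' x ?e1 = ht (ddir ?e1 F x)" "p x \<bullet> X' x ?e2 = ht (ddir ?e2 F x)"
      unfolding p_def J_def by (rule gradient_by_Cramer, rule J0[OF x, unfolded J_def])+
    have "X' x u = u $ 1 *\<^sub>R X' x ?e1 + u $ 2 *\<^sub>R X' x ?e2"
      by (subst vec2_decompose[of u]) (simp only: linear_add[OF X'lin[OF xU]] linear_scale[OF X'lin[OF xU]])
    moreover have "ht (ddir u F x) = u $ 1 * ht (ddir ?e1 F x) + u $ 2 * ht (ddir ?e2 F x)"
      by (subst vec2_decompose[of u])
         (simp only: linear_add[OF linF[OF xU]] linear_scale[OF linF[OF xU]]
           linear_add[OF ht_lin] linear_scale[OF ht_lin] real_scaleR_def)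
    ultimately show ?thesis by (simp add: inner_add_right b)
  qed
  define p' where "p' x = frechet_derivative p (at x)" for x
  have dp: "(p has_derivative p' x) (at x)" if x: "x \<in> U1" for x
  proof -
    have xU: "x \<in> U" using x U1 by blast
    have h: "(\<lambda>x. ht (ddir v F x)) differentiable (at x)" for v
      using bounded_linear.has_derivative[OF ht ddF[OF xU]] by (rule differentiableI)
    have a: "(\<lambda>x. X' x v $ i) differentiable (at x)" for v i
      unfolding X'_def
      using bounded_linear.has_derivative[OF bounded_linear_vec_nth bounded_linear.has_derivative[OF pr ddF[OF xU]]]
      by (rule differentiableI)
    have "p differentiable (at x)"
      unfolding p_def[abs_def] J_def
      by (intro differentiable_add differentiable_scaleR differentiable_divide differentiable_diff
          differentiable_mult differentiable_const h a J0[OF x, unfolded J_def])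
    then show ?thesis unfolding p'_def by (simp only: frechet_derivative_works[symmetric])
  qed
  have key: "p' x u \<bullet> X' x v = \<kappa> * g x u v" if x: "x \<in> U1" for x u v
  proof -
    have xU: "x \<in> U" using x U1 by blast
    have "((\<lambda>x. p x \<bullet> X' x v) has_derivative
        (\<lambda>u. p x \<bullet> pr (ddir u (ddir v F) x) + p' x u \<bullet> X' x v)) (at x)"
      unfolding X'_def
      by (rule has_derivative_inner[OF dp[OF x] bounded_linear.has_derivative[OF pr ddF[OF xU]]])
    then have "((\<lambda>x. ht (ddir v F x)) has_derivative
        (\<lambda>u. p x \<bullet> pr (ddir u (ddir v F) x) + p' x u \<bullet> X' x v)) (at x)"
      by (rule has_derivative_transform_within_open[OF _ U1(1) x]) (rule p)
    from has_derivative_unique[OF this bounded_linear.has_derivative[OF ht ddF[OF xU]]]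
    have 1: "p x \<bullet> pr (ddir u (ddir v F) x) + p' x u \<bullet> X' x v = ht (ddir u (ddir v F) x)"
      by (simp add: fun_eq_iff)
    define \<Gamma> where "\<Gamma> = conn F Z x u v"
    have "ddir u (ddir v F) x = ddir \<Gamma> F x + g x u v *\<^sub>R Z0"
      using dec(1)[OF xU, of "ddir u (ddir v F) x"] Zconst[of x] x U1(2)
      by (auto simp: \<Gamma>_def g_def conn_def sff_def)
    then have "pr (ddir u (ddir v F) x) = X' x \<Gamma>" "ht (ddir u (ddir v F) x) = ht (ddir \<Gamma> F x) + g x u v * \<kappa>"
      by (simp_all add: linear_add[OF pr_lin] linear_scale[OF pr_lin] linear_add[OF ht_lin]
          linear_scale[OF ht_lin] prZ X'_def)
    with 1 p[OF x, of \<Gamma>] show ?thesis by simp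
  qed
  have lin1: "linear (\<lambda>u. \<kappa> * g x u v)" and lin2: "linear (\<lambda>v. \<kappa> * g x u v)" if x: "x \<in> U1" for x u v
  proof -
    have xU: "x \<in> U" using x U1 by blast
    note l = has_derivative_linear[OF dp[OF x]] X'lin[OF xU]
    show "linear (\<lambda>u. \<kappa> * g x u v)" "linear (\<lambda>v. \<kappa> * g x u v)"
      unfolding key[OF x, symmetric]
      by (rule linearI; simp add: linear_add[OF l(1)] linear_scale[OF l(1)] linear_add[OF l(2)]
          linear_scale[OF l(2)] inner_add_left inner_add_right)+
  qed
  have detg: "det (gram (\<lambda>u v. \<kappa> * g x u v)) = (J x)\<^sup>2" if x: "x \<in> U1" for x
  proof -
    have xU: "x \<in> U" using x U1 by blast
    have eq: "det (gram (\<lambda>u v. \<kappa> * g x u v)) = \<kappa>\<^sup>2 * det (gram (g x))"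
      by (simp add: gram_def det_2 power2_eq_square algebra_simps)
    have "det (gram (\<lambda>u v. \<kappa> * g x u v)) > 0"
      by (rule definite_det_gram_pos[OF lin1[OF x] lin2[OF x]])
         (simp add: g_sym[OF xU, symmetric], rule \<kappa>g[OF x])
    then have "det (gram (g x)) > 0" unfolding eq by (simp add: zero_less_mult_iff)
    then have "(vol_form F Z x ?e1 ?e2)\<^sup>2 = det (gram (g x))"
      unfolding vol[OF xU] g_def by simp
    then show ?thesis unfolding eq J[OF x] by simp
  qed
  define \<Psi> where "\<Psi> y = ht (F (G y))" for y
  define B where "B y = matrix (\<lambda>w. p' (G y) (G' y w))" for y
  have B: "B y $ i $ j = \<kappa> * g (G y) (G' y (axis j 1)) (G' y (axis i 1))" if y: "y \<in> V" for y i j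
  proof -
    have "B y $ i $ j = p' (G y) (G' y (axis j 1)) \<bullet> axis i 1"
      by (simp add: B_def matrix_def inner_axis)
    \<comment> \<open>Tangent vectors \<open>G' y (axis i 1)\<close> lift the coordinate vectors of the graph domain.\<close>
    also have "axis i 1 = X' (G y) (G' y (axis i 1))" by (rule G'[OF y, symmetric])
    also have "p' (G y) (G' y (axis j 1)) \<bullet> \<dots> = \<kappa> * g (G y) (G' y (axis j 1)) (G' y (axis i 1))"
      by (rule key[OF GU(2)[OF y]])
    finally show ?thesis .
  qed
  have "real_analytic_on V \<Psi>"
  proof (rule Monge_Ampere_imp_real_analytic[OF V, where P = "\<lambda>y. p (G y)" and B = B])
    fix y assume y: "y \<in> V"
    note x = GU(2)[OF y] and xU = GU(3)[OF y]
    let ?s = "G' y (axis 1 1)" and ?t = "G' y (axis 2 1)"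
    have "(\<Psi> has_derivative (\<lambda>w. ht (ddir (G' y w) F (G y)))) (at y)"
      unfolding \<Psi>_def by (rule bounded_linear.has_derivative[OF ht has_derivative_compose[OF dG[OF y] dF[OF xU]]])
    then show "(\<Psi> has_derivative (\<lambda>v. p (G y) \<bullet> v)) (at y)"
      unfolding p[OF x, symmetric] G'[OF y] .
    have d: "((\<lambda>y. p (G y)) has_derivative (\<lambda>w. p' (G y) (G' y w))) (at y)"
      by (rule has_derivative_compose[OF dG[OF y] dp[OF x]])
    then show "((\<lambda>y. p (G y)) has_derivative (\<lambda>v. B y *v v)) (at y)"
      using has_derivative_linear[OF d] by (simp add: B_def matrix_works)
    show "B y $ 1 $ 2 = B y $ 2 $ 1" unfolding B[OF y] by (subst g_sym[OF xU]) simp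
    have s: "?s \<noteq> 0"
    proof
      assume "?s = 0"
      then have "X' (G y) 0 = axis 1 1" using G'[OF y, of "axis 1 1"] by simp
      then show False using linear_0[OF X'lin[OF xU]] by (simp add: axis_eq_0_iff)
    qed
    show "B y $ 1 $ 1 > 0" unfolding B[OF y] by (rule \<kappa>g[OF x s])
    have comp: "X' (G y) w = w $ 1 *\<^sub>R X' (G y) ?e1 + w $ 2 *\<^sub>R X' (G y) ?e2" for w
      by (subst vec2_decompose[of w]) (simp only: linear_add[OF X'lin[OF xU]] linear_scale[OF X'lin[OF xU]])
    have "(?s $ 1 * ?t $ 2 - ?s $ 2 * ?t $ 1) * J (G y) =
        X' (G y) ?s $ 1 * X' (G y) ?t $ 2 - X' (G y) ?s $ 2 * X' (G y) ?t $ 1"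
      unfolding comp[of ?s] comp[of ?t] J_def by (simp add: algebra_simps)
    also have "\<dots> = 1" unfolding G'[OF y] by (simp add: axis_def)
    finally have 1: "(?s $ 1 * ?t $ 2 - ?s $ 2 * ?t $ 1) * J (G y) = 1" .
    have "det (B y) = det (gram (\<lambda>u v. \<kappa> * g (G y) u v)) * (?s $ 1 * ?t $ 2 - ?s $ 2 * ?t $ 1)\<^sup>2"
      unfolding det_2[of "B y"] B[OF y] using bilinear2_det(2)[OF lin1[OF x] lin2[OF x], of ?s ?t] by (simp add: mult.commute)
    also have "\<dots> = ((?s $ 1 * ?t $ 2 - ?s $ 2 * ?t $ 1) * J (G y))\<^sup>2"
      unfolding detg[OF x] by (simp add: power_mult_distrib)
    finally show "det (B y) = 1" unfolding 1 by simp
  qed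
  moreover have "(\<lambda>x. M *v F x) ` U' = (\<lambda>y. vector [y $ 1, y $ 2, \<Psi> y]) ` V"
  proof -
    have "M *v F x = vector [X x $ 1, X x $ 2, \<Psi> (X x)]" if "x \<in> U'" for x
    proof -
      have "G (X x) = x" using homeomorphism_apply1[OF hom that] .
      then have "\<Psi> (X x) = (M *v F x) $ 3" by (simp add: \<Psi>_def ht_def)
      then show ?thesis by (simp add: X_def pr_def vec_eq_iff forall_3)
    qed
    then have "(\<lambda>x. M *v F x) ` U' = (\<lambda>x. vector [X x $ 1, X x $ 2, \<Psi> (X x)]) ` U'"
      by (intro image_cong) auto
    also have "\<dots> = (\<lambda>y. vector [y $ 1, y $ 2, \<Psi> y]) ` X ` U'" by (simp add: image_image)
    also have "X ` U' = V" using hom unfolding homeomorphism_def by blast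
    finally show ?thesis .
  qed
  ultimately show thesis
    using that[OF U'(1,3) _ M(1) V] U'(2) U1(3) by blast
qed

section \<open>Improper affine spheres\<close>

theorem corollary1p2:
  fixes N :: "'a::{second_countable_topology, t2_space} set"
    and A :: "'a chart set"
    and f \<xi> :: "'a \<Rightarrow> real^3"
  assumes "oriented_surface N A"
    and "immersion_on A f"
    and "affine_normal A f \<xi>"
    and "locally_strongly_convex A f \<xi>"
    and "improper_affine_sphere A f \<xi>"
    and "\<forall>c\<in>A. \<forall>p\<in>fst c. pick_invariant c f \<xi> p \<noteq> 0"
  shows "analytic_surface N f"
  unfolding analytic_surface_def
proof
  fix q assume "q \<in> N"
  with assms(1) obtain c where c: "c \<in> A" "q \<in> fst c" "fst c \<subseteq> N" "is_chart c"
    unfolding oriented_surface_def by blast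
  let ?F = "f \<circ> param c" and ?Z = "\<xi> \<circ> param c"
  have op: "open (fst c)" "open (coord_dom c)"
    and hom: "homeomorphism (fst c) (coord_dom c) (snd c) (param c)"
    using c(4) by (auto simp: is_chart_def)
  have q: "snd c q \<in> coord_dom c" using c(2) by blast
  obtain U' and M :: "real^3^3" and W :: "(real^2) set" and \<Psi> :: "real^2 \<Rightarrow> real" where U': "open U'" "snd c q \<in> U'" "U' \<subseteq> coord_dom c"
    and MW: "invertible M" "open W" "real_analytic_on W \<Psi>"
      "(\<lambda>x. M *v ?F x) ` U' = (\<lambda>y. vector [y $ 1, y $ 2, \<Psi> y]) ` W"
  proof (rule improper_affine_sphere_local_graph[OF op(2) q, of ?F ?Z])
    show "smooth_on (coord_dom c) ?F" "\<And>x. x \<in> coord_dom c \<Longrightarrow> inj (frechet_derivative ?F (at x))"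
      using assms(2) c(1) by (auto simp: immersion_on_def)
    have equi: "equiaffine A f \<xi>" using assms(3) by (simp add: affine_normal_def)
    then show "\<And>x u v w. x \<in> coord_dom c \<Longrightarrow> nabla_vol ?F ?Z x u v w = 0"
      using c(1) unfolding equiaffine_def by blast
    have "transversal_field A f \<xi>" using equi by (simp add: equiaffine_def)
    then show "smooth_on (coord_dom c) ?Z"
      "\<And>x. x \<in> coord_dom c \<Longrightarrow> ?Z x \<notin> range (frechet_derivative ?F (at x))"
      using c(1) unfolding transversal_field_def by blast+
    show "\<And>x. x \<in> coord_dom c \<Longrightarrow>
      vol_form ?F ?Z x (axis 1 1) (axis 2 1) = sqrt \<bar>det (gram (sff ?F ?Z x))\<bar>"
      using assms(3) c(1) unfolding affine_normal_def by blast
    show "\<And>x. x \<in> coord_dom c \<Longrightarrow>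
      (\<forall>u. u \<noteq> 0 \<longrightarrow> sff ?F ?Z x u u > 0) \<or> (\<forall>u. u \<noteq> 0 \<longrightarrow> sff ?F ?Z x u u < 0)"
      using assms(4) c(1) unfolding locally_strongly_convex_def by blast
    have "\<forall>c\<in>A. \<forall>x\<in>coord_dom c. \<forall>u. shape_op (f \<circ> param c) (\<xi> \<circ> param c) x u = 0 *\<^sub>R u"
      using assms(5) unfolding affine_sphere_def by blast
    then show "\<And>x u. x \<in> coord_dom c \<Longrightarrow> shape_op ?F ?Z x u = 0"
      using c(1) by (metis scaleR_zero_left)
  qed blast
  define V where "V = fst c \<inter> snd c -` U'"
  have V: "open V" "q \<in> V" "V \<subseteq> N"
    using continuous_open_preimage[OF homeomorphism_cont1[OF hom] op(1) U'(1)] c(2,3) U'(2)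
    by (auto simp: V_def)
  have V_eq: "param c ` U' = V"
  proof -
    have "param c (snd c p) = p" if "p \<in> fst c" for p using hom that by (simp add: homeomorphism_def)
    moreover have "snd c (param c x) = x" "param c x \<in> fst c" if "x \<in> coord_dom c" for x
      using hom that unfolding homeomorphism_def by blast+
    ultimately show ?thesis using U'(3) by (force simp: V_def)
  qed
  have V_graph: "(\<lambda>p. M *v f p + 0) ` V = (\<lambda>x. M *v ?F x) ` U'"
    unfolding V_eq[symmetric] image_image by simp
  have "(\<lambda>p. M *v f p + 0) ` V = (\<lambda>y. vector [y $ 1, y $ 2, \<Psi> y]) ` W"
    unfolding V_graph MW(4) ..
  with V MW(1-3) show "\<exists>V. open V \<and> q \<in> V \<and> V \<subseteq> N \<and>
        (\<exists>(M :: real^3^3) b W \<Psi>. invertible M \<and> open W \<and> real_analytic_on W \<Psi> \<and>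
           (\<lambda>p. M *v f p + b) ` V = (\<lambda>x. vector [x$1, x$2, \<Psi> x]) ` W)"
    by blast
qed

end
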